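(* Let $(\mu_\varepsilon)_{0\le\varepsilon\le1}$ be a family of probability distributions on $\mathbb{R}$ with cumulant generating functions $K_\varepsilon$, and let $x\in\mathbb{R}$ satisfy $\int_{\mathbb{R}}y\,\mu_0(dy)\neq x$. Assume: (A1) for each $\varepsilon\in[0,1]$, the effective domain $\mathcal{D}_\varepsilon$ of $K_\varepsilon$ contains an open interval that includes $0$; (A2) for each $\varepsilon\in[0,1]$, the support of $\mu_\varepsilon$ is equal to $\mathbb{R}$, and the characteristic function of $\mu_\varepsilon$ is integrable, i.e. $\int_{-\infty}^\infty\left|\int_{-\infty}^\infty e^{i\xi y}\mu_\varepsilon(dy)\right|d\xi<\infty$; (A3) there is $\delta_0>0$ such that $K''_\varepsilon(\theta)\ge\delta_0$ for each $\theta\in\mathcal{O}_\varepsilon$ and $\varepsilon\in[0,1]$; (A4) for each $\varepsilon$ there is an interval $\mathcal{I}_\varepsilon\subset\mathcal{D}_\varepsilon$ such that $\mathcal{I}_\varepsilon\nearrow\mathbb{R}$ as $\varepsilon\to0$; that is, $\mathcal{I}_\varepsilon\subset\mathcal{I}_{\varepsilon'}$ for each $\varepsilon\ge\varepsilon'$, and $\bigcup_\varepsilon\mathcal{I}_\varepsilon=\mathbb{R}$; (A5) for each nonnegative integer $r$, $K^{(r)}_\varepsilon$ converges to $K^{(r)}_0$ uniformly on any compact subset of $\mathbb{R}$ as $\varepsilon\to0$; moreover, for each integer $r\ge3$ and each compact $C\subset\mathbb{R}$, $\limsup_{\varepsilon\to0}\sup_{\theta\in C}\varepsilon^{-(r-2)}|K^{(r)}_\varepsilon(\theta)|<\infty$.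 Then, as $\varepsilon\to0$, $\Psi^\varepsilon_0(\hat w_\varepsilon)=O(\varepsilon)$, and $\Psi^\varepsilon_m(\hat w_\varepsilon)=O(\varepsilon^3)$ for each $m\ge1$.
   Context: $K_\varepsilon(\theta)=\log\int_{\mathbb{R}}e^{\theta y}\mu_\varepsilon(dy)$; $\mathcal{D}_\varepsilon=\{\theta\in\mathbb{R}:|K_\varepsilon(\theta)|<\infty\}$; $\mathcal{O}_\varepsilon$ is the interior of $\mathcal{D}_\varepsilon$. The saddlepoint $\hat\theta_\varepsilon\in\mathcal{O}_\varepsilon$ is the solution of $K'_\varepsilon(\hat\theta_\varepsilon)=x$; the source states that under (A1)–(A2) $K_\varepsilon$ is strictly convex and the range of $K'_\varepsilon$ is $\mathbb{R}$, so that this solution always exists. (By (A4), every compact set lies in $\mathcal{D}_\varepsilon$ for small $\varepsilon$, so (A5) makes sense for small $\varepsilon$; under the assumptions $\hat\theta_\varepsilon\ne0$ for small $\varepsilon$.) Set $\mathrm{sgn}(a)=1$ for $a\ge0$, $-1$ for $a<0$, and $\hat w_\varepsilon=\mathrm{sgn}(\hat\theta_\varepsilon)\sqrt{2(x\hat\theta_\varepsilon-K_\varepsilon(\hat\theta_\varepsilon))}$. Put $$w_\varepsilon(\theta)=\hat w_\varepsilon+\mathrm{sgn}(\theta-\hat\theta_\varepsilon)\sqrt{2\{(K_\varepsilon(\theta)-x\theta)-(K_\varepsilon(\hat\theta_\varepsilon)-x\hat\theta_\varepsilon)\}},$$ which is real analytic on $\mathcal{O}_\varepsilon$ with nonvanishing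 derivative; let $\theta_\varepsilon(w)$ be its analytic inverse function, so that $\frac12w^2-\hat w_\varepsilon w=K_\varepsilon(\theta_\varepsilon(w))-x\theta_\varepsilon(w)$ and $\theta_\varepsilon(\hat w_\varepsilon)=\hat\theta_\varepsilon$. Define $$\psi_\varepsilon(w)=\frac{\theta_\varepsilon'(w)}{\theta_\varepsilon(w)}-\frac1w,\qquad \Psi^\varepsilon_m(w)=\phi(w)\frac{(-1)^m}{(2m)!!}\psi_\varepsilon^{(2m)}(w),$$ with $(2m)!!=(2m)(2m-2)\cdots4\cdot2$, $0!!=1$, and $\phi(y)=\frac1{\sqrt{2\pi}}e^{-y^2/2}$. $a_\varepsilon=O(\varepsilon^r)$ as $\varepsilon\to0$ means $\limsup_{\varepsilon\to0}\varepsilon^{-r}|a_\varepsilon|<\infty$. *)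

theory Defs
  imports "HOL-Probability.Probability" "HOL-Library.Landau_Symbols"
begin

(* The integral is positive for every probability measure, so the value -infinity does not occur. *)
definition cgf_ext :: "real measure \<Rightarrow> real \<Rightarrow> ereal" where
  "cgf_ext M \<theta> =
     (let L = (\<integral>\<^sup>+ y. ennreal (exp (\<theta> * y)) \<partial>M)
      in if L = \<infinity> then \<infinity> else ereal (ln (enn2real L)))"

definition effective_domain :: "real measure \<Rightarrow> real set" where
  "effective_domain M = {\<theta>. \<bar>cgf_ext M \<theta>\<bar> < \<infinity>}"

(* Real-valued version; meaningful on effective_domain M, with value 0 elsewhere. *)
definition cgf :: "real measure \<Rightarrow> real \<Rightarrow> real" where
  "cgf M \<theta> = real_of_ereal (cgf_ext M \<theta>)"

definition measure_support :: "real measure \<Rightarrow> real set" where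
  "measure_support M = {y. \<forall>U. open U \<and> y \<in> U \<longrightarrow> emeasure M U > 0}"

(* A meaningful value requires x to be in the range of the derivative of cgf M on the interior
   of the effective domain; strict convexity then makes the solution unique. *)
definition saddlepoint :: "real measure \<Rightarrow> real \<Rightarrow> real" where
  "saddlepoint M x = (THE \<theta>. \<theta> \<in> interior (effective_domain M) \<and> deriv (cgf M) \<theta> = x)"

(* Unlike the library's sgn, this has value 1 at 0. *)
definition sgn1 :: "real \<Rightarrow> real" where
  "sgn1 a = (if a \<ge> 0 then 1 else -1)"

definition w_hat :: "real measure \<Rightarrow> real \<Rightarrow> real" where
  "w_hat M x =
     (let \<theta>h = saddlepoint M x in sgn1 \<theta>h * sqrt (2 * (x * \<theta>h - cgf M \<theta>h)))"

definition w_fun :: "real measure \<Rightarrow> real \<Rightarrow> real \<Rightarrow> real" where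
  "w_fun M x \<theta> =
     (let \<theta>h = saddlepoint M x in
        w_hat M x + sgn1 (\<theta> - \<theta>h) *
          sqrt (2 * ((cgf M \<theta> - x * \<theta>) - (cgf M \<theta>h - x * \<theta>h))))"

definition theta_fun :: "real measure \<Rightarrow> real \<Rightarrow> real \<Rightarrow> real" where
  "theta_fun M x = inv_into (interior (effective_domain M)) (w_fun M x)"

(* theta_fun M x vanishes at w = 0, where psi therefore has a removable singularity;
   the value assigned by division by 0 there is irrelevant away from w = 0. *)
definition psi :: "real measure \<Rightarrow> real \<Rightarrow> real \<Rightarrow> real" where
  "psi M x w = deriv (theta_fun M x) w / theta_fun M x w - 1 / w"

definition even_double_fact :: "nat \<Rightarrow> real" where
  "even_double_fact m = (\<Prod>k=1..m. 2 * real k)"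

definition Psi :: "real measure \<Rightarrow> real \<Rightarrow> nat \<Rightarrow> real \<Rightarrow> real" where
  "Psi M x m w =
     std_normal_density w * ((-1) ^ m / even_double_fact m) * (deriv ^^ (2 * m)) (psi M x) w"

end

theory Submission
  imports Defs "HOL-Complex_Analysis.Complex_Analysis"
begin

text \<open>
  Assumption (A5) says that \<open>K\<close> scales like \<open>K(\<theta>) = \<epsilon>\<^sup>-\<^sup>2 \<kappa>(\<epsilon> \<theta>)\<close>: every derivative of \<open>K''\<close> gains a factor
  \<open>\<epsilon>\<close>. Functions with this property are closed under products, composition, inverses, square roots
  and averages over segments. With \<open>\<tau>\<close> the saddlepoint, Taylor's formula gives
  \<open>w(\<theta>) = w(\<tau>) + (\<theta> - \<tau>) sqrt (2 G(\<theta>))\<close> and \<open>w'(\<theta>) = H(\<theta>) / sqrt (2 G(\<theta>))\<close>, where \<open>G\<close> and \<open>H\<close> are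
  averages of \<open>K''\<close> over the segment from \<open>\<tau>\<close> to \<open>\<theta>\<close>; so \<open>w'\<close> has the property, and so does
  \<open>\<theta>'(w) = 1 / w'(\<theta>(w))\<close>. Since \<open>w(0) = 0\<close>, also \<open>p(\<theta>) = w(\<theta>) / \<theta>\<close>, the average of \<open>w'\<close> over the segment
  from \<open>0\<close> to \<open>\<theta>\<close>, has it, and \<open>\<psi>\<close> is minus the logarithmic derivative of \<open>p(\<theta>(w))\<close>. Hence the \<open>k\<close>-th
  derivative of \<open>\<psi>\<close> is \<open>O(\<epsilon>\<^sup>k\<^sup>+\<^sup>1)\<close>.
\<close>

section \<open>Smoothness of the cumulant generating function\<close>

lemma effective_domain_iff:
  assumes "real_distribution M"
  shows "\<theta> \<in> effective_domain M \<longleftrightarrow> integrable M (\<lambda>y. exp (\<theta> * y))"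
proof -
  interpret real_distribution M by fact
  have "integrable M (\<lambda>y. exp (\<theta> * y)) \<longleftrightarrow> (\<integral>\<^sup>+ y. ennreal (exp (\<theta> * y)) \<partial>M) < \<infinity>"
    by (simp add: integrable_iff_bounded)
  then show ?thesis
    by (auto simp: effective_domain_def cgf_ext_def Let_def less_top)
qed

lemma cgf_eq:
  assumes "real_distribution M" and "\<theta> \<in> effective_domain M"
  shows "cgf M \<theta> = ln (\<integral>y. exp (\<theta> * y) \<partial>M)"
proof -
  interpret real_distribution M by fact
  have i: "integrable M (\<lambda>y. exp (\<theta> * y))"
    using assms effective_domain_iff by blast
  have "(\<integral>\<^sup>+ y. ennreal (exp (\<theta> * y)) \<partial>M) = ennreal (\<integral>y. exp (\<theta> * y) \<partial>M)"
    by (rule nn_integral_eq_integral[OF i]) simp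
  then show ?thesis
    by (simp add: cgf_def cgf_ext_def Let_def)
qed

lemma cgf_0:
  assumes "real_distribution M"
  shows "cgf M 0 = 0"
proof -
  interpret real_distribution M by fact
  show ?thesis
    using cgf_eq[OF assms, of 0] effective_domain_iff[OF assms, of 0] prob_space by simp
qed

text \<open>A nonnegative function with zero integral vanishes almost everywhere, which the
  exponential cannot do under a probability measure.\<close>

lemma exp_integral_pos:
  assumes "real_distribution M" and "integrable M (\<lambda>y. exp (\<theta> * y))"
  shows "(\<integral>y. exp (\<theta> * y) \<partial>M) > 0"
proof -
  interpret real_distribution M by fact
  have "(\<integral>y. exp (\<theta> * y) \<partial>M) \<noteq> 0"
    using integral_nonneg_eq_0_iff_AE[OF assms(2)] by auto
  moreover have "(\<integral>y. exp (\<theta> * y) \<partial>M) \<ge> 0" by simp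
  ultimately show ?thesis by linarith
qed

text \<open>The exponent at a convex combination is at most the larger of the two end exponents, so
  the sum of the two integrable exponentials dominates.\<close>

lemma convex_effective_domain:
  assumes "real_distribution M"
  shows "convex (effective_domain M)"
proof (rule convexI)
  interpret real_distribution M by fact
  fix s t u v :: real
  assume st: "s \<in> effective_domain M" "t \<in> effective_domain M" and uv: "0 \<le> u" "0 \<le> v" "u + v = 1"
  have "exp ((u * s + v * t) * y) \<le> exp (s * y) + exp (t * y)" for y
  proof -
    have "(u * s + v * t) * y = u * (s * y) + v * (t * y)" by (simp add: algebra_simps)
    also have "\<dots> \<le> u * max (s * y) (t * y) + v * max (s * y) (t * y)"
      using uv by (intro add_mono mult_left_mono) auto
    also have "\<dots> = max (s * y) (t * y)" using uv by (simp flip: distrib_right)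
    finally have "exp ((u * s + v * t) * y) \<le> exp (max (s * y) (t * y))" by simp
    then show ?thesis by (smt (verit) exp_gt_zero max_def)
  qed
  moreover have "integrable M (\<lambda>y. exp (s * y) + exp (t * y))"
    using st effective_domain_iff[OF assms] by auto
  ultimately have "integrable M (\<lambda>y. exp ((u * s + v * t) * y))"
    by (rule_tac Bochner_Integration.integrable_bound) auto
  then show "u *\<^sub>R s + v *\<^sub>R t \<in> effective_domain M"
    using effective_domain_iff[OF assms] by simp
qed

section \<open>Local analyticity of the exponential integral and of its logarithm\<close>

text \<open>Expand \<open>exp (h * y)\<close> and integrate term by term. The absolute series sums
  to \<open>exp \<bar>h * y\<bar> * exp (\<theta> * y)\<close>, and \<open>\<bar>h * y\<bar>\<close>
  is \<open>h * y\<close> or its negative; integrability at both \<open>\<theta> + h\<close> and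
  \<open>\<theta> - h\<close> therefore gives a dominating function.\<close>

lemma exp_integral_power_series:
  assumes "real_distribution M"
    and "integrable M (\<lambda>y. exp ((\<theta> + h) * y))" "integrable M (\<lambda>y. exp ((\<theta> - h) * y))"
  shows "(\<lambda>k. (\<integral>y. y ^ k * exp (\<theta> * y) \<partial>M) / fact k * h ^ k) sums (\<integral>y. exp ((\<theta> + h) * y) \<partial>M)"
proof -
  interpret real_distribution M by fact
  define f where "f k y = (h * y) ^ k /\<^sub>R fact k * exp (\<theta> * y)" for k y
  have norm_f: "norm (f k y) = \<bar>h * y\<bar> ^ k /\<^sub>R fact k * exp (\<theta> * y)" for k y
    by (simp add: f_def abs_mult power_abs)
  have sums_norm: "(\<lambda>k. norm (f k y)) sums (exp \<bar>h * y\<bar> * exp (\<theta> * y))" for y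
    unfolding norm_f by (intro sums_mult2 exp_converges)
  have bound: "exp \<bar>h * y\<bar> * exp (\<theta> * y) \<le> exp ((\<theta> + h) * y) + exp ((\<theta> - h) * y)" for y
  proof (cases "h * y \<ge> 0")
    case True
    then have "exp \<bar>h * y\<bar> * exp (\<theta> * y) = exp ((\<theta> + h) * y)"
      by (simp add: algebra_simps flip: exp_add)
    then show ?thesis by simp
  next
    case False
    then have "exp \<bar>h * y\<bar> * exp (\<theta> * y) = exp ((\<theta> - h) * y)"
      by (simp add: algebra_simps flip: exp_add)
    then show ?thesis by simp
  qed
  have int_dom: "integrable M (\<lambda>y. exp ((\<theta> + h) * y) + exp ((\<theta> - h) * y))"
    using assms by auto
  have part: "(\<Sum>k<n. norm (f k y)) \<le> exp ((\<theta> + h) * y) + exp ((\<theta> - h) * y)" for n y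
    by (rule order_trans[OF _ bound], subst sums_unique[OF sums_norm])
       (rule sum_le_suminf, use sums_norm in \<open>auto simp: sums_iff\<close>)
  have single: "norm (f k y) \<le> exp ((\<theta> + h) * y) + exp ((\<theta> - h) * y)" for k y
    by (rule order_trans[OF _ part[of y "Suc k"]]) (simp add: sum_nonneg del: real_norm_def)
  have int_f: "integrable M (f k)" for k
    by (rule Bochner_Integration.integrable_bound[OF int_dom])
       (use order_trans[OF single abs_ge_self] in \<open>auto simp: f_def[abs_def]\<close>)
  have "(\<lambda>k. \<integral>y. f k y \<partial>M) sums (\<integral>y. (\<Sum>k. f k y) \<partial>M)"
  proof (rule sums_integral)
    show "integrable M (f k)" for k by (rule int_f)
    show "AE y in M. summable (\<lambda>k. norm (f k y))"
      using sums_norm by (auto simp: sums_iff)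
    show "summable (\<lambda>k. \<integral>y. norm (f k y) \<partial>M)"
    proof (rule summableI_nonneg_bounded)
      fix n
      have "(\<Sum>k<n. \<integral>y. norm (f k y) \<partial>M) = (\<integral>y. (\<Sum>k<n. norm (f k y)) \<partial>M)"
        by (rule Bochner_Integration.integral_sum[symmetric]) (use int_f in auto)
      also have "\<dots> \<le> (\<integral>y. exp ((\<theta> + h) * y) + exp ((\<theta> - h) * y) \<partial>M)"
        by (rule integral_mono) (use int_f int_dom part in auto)
      finally show "(\<Sum>k<n. \<integral>y. norm (f k y) \<partial>M) \<le> \<dots>" .
    qed simp
  qed
  moreover have "(\<Sum>k. f k y) = exp ((\<theta> + h) * y)" for y
    unfolding f_def using sums_mult2[OF exp_converges[of "h * y"], of "exp (\<theta> * y)"]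
    by (simp add: sums_iff algebra_simps exp_add)
  moreover have "(\<integral>y. f k y \<partial>M) = (\<integral>y. y ^ k * exp (\<theta> * y) \<partial>M) / fact k * h ^ k" for k
  proof -
    have "f k = (\<lambda>y. h ^ k / fact k * (y ^ k * exp (\<theta> * y)))"
      by (auto simp: f_def power_mult_distrib field_simps)
    then show ?thesis by simp
  qed
  ultimately show ?thesis by simp
qed

text \<open>The real power series around \<open>\<theta>\<close> also converges for complex
  arguments in the disc of the same radius; its sum is the extension \<open>F\<close>, and its
  coefficient of index 1 is the derivative at the centre.\<close>

lemma exp_integral_locally_holomorphic:
  assumes M: "real_distribution M" and \<theta>: "\<theta> \<in> interior (effective_domain M)"
  obtains r F where "r > 0" "F holomorphic_on ball (of_real \<theta>) r" "ball \<theta> r \<subseteq> effective_domain M"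
    "deriv F (of_real \<theta>) = of_real (\<integral>y. y * exp (\<theta> * y) \<partial>M)"
    "\<And>t. t \<in> ball \<theta> r \<Longrightarrow> F (of_real t) = of_real (\<integral>y. exp (t * y) \<partial>M)"
proof -
  \<comment> \<open>A closed ball is taken so that the series can be evaluated at
    \<open>h = r\<close> itself; convergence at that one point yields the whole open complex
    disc.\<close>
  obtain r where r: "r > 0" "cball \<theta> r \<subseteq> effective_domain M"
    using \<theta> by (auto simp: mem_interior_cball)
  define c where "c k = (\<integral>y. y ^ k * exp (\<theta> * y) \<partial>M) / fact k" for k
  have c: "(\<lambda>k. c k * h ^ k) sums (\<integral>y. exp ((\<theta> + h) * y) \<partial>M)" if "\<bar>h\<bar> \<le> r" for h
    unfolding c_def
  proof (rule exp_integral_power_series[OF M])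
    have "\<theta> + h \<in> cball \<theta> r" "\<theta> - h \<in> cball \<theta> r" using that by (auto simp: dist_real_def)
    then show "integrable M (\<lambda>y. exp ((\<theta> + h) * y))" "integrable M (\<lambda>y. exp ((\<theta> - h) * y))"
      using r effective_domain_iff[OF M] by blast+
  qed
  have "summable (\<lambda>k. complex_of_real (c k) * of_real r ^ k)"
    using c[of r] r summable_of_real[of "\<lambda>k. c k * r ^ k", where 'a = complex] by (auto simp: sums_iff)
  then obtain g g' where gg: "\<forall>z. cmod z < r \<longrightarrow> (\<lambda>k. of_real (c k) * z ^ k) sums g z \<and>
      (\<lambda>k. of_nat k * of_real (c k) * z ^ (k - 1)) sums g' z \<and> (g has_field_derivative g' z) (at z)"
    using power_series_and_derivative_0[of "\<lambda>k. of_real (c k)" r] by auto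
  note g = gg[rule_format, THEN conjunct1] gg[rule_format, THEN conjunct2, THEN conjunct1]
    gg[rule_format, THEN conjunct2, THEN conjunct2]
  define F where "F z = g (z - of_real \<theta>)" for z
  have dF: "(F has_field_derivative g' (z - of_real \<theta>)) (at z)" if "z \<in> ball (of_real \<theta>) r" for z
  proof -
    have "(g has_field_derivative g' (z - of_real \<theta>)) (at (z + - of_real \<theta>))"
      using g(3)[of "z - of_real \<theta>"] that by (simp add: dist_norm norm_minus_commute)
    then show ?thesis
      unfolding DERIV_shift by (simp add: F_def[abs_def])
  qed
  show ?thesis
  proof
    show "r > 0" by fact
    show "F holomorphic_on ball (of_real \<theta>) r"
      unfolding holomorphic_on_open[OF open_ball] using dF by blast
    show "ball \<theta> r \<subseteq> effective_domain M"
      using r(2) by auto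
    \<comment> \<open>By truncated subtraction \<open>0 ^ (k - 1)\<close> is 1 for
      \<open>k = 0\<close> as well as for \<open>k = 1\<close>; the factor \<open>of_nat k\<close>
      removes the former.\<close>
    have "(\<lambda>k. of_nat k * of_real (c k) * 0 ^ (k - 1)) sums (complex_of_real (c 1))"
      using sums_single[of 1 "\<lambda>k. of_nat k * complex_of_real (c k) * 0 ^ (k - 1)"]
      by (auto elim!: sums_cong[THEN iffD1, rotated] simp: power_0_left)
    then have "g' 0 = of_real (c 1)"
      using g(2)[of 0] r(1) sums_unique2 by fastforce
    then show "deriv F (of_real \<theta>) = of_real (\<integral>y. y * exp (\<theta> * y) \<partial>M)"
      using dF[of "of_real \<theta>"] r(1) by (auto intro!: DERIV_imp_deriv simp: c_def)
    show "F (of_real t) = of_real (\<integral>y. exp (t * y) \<partial>M)" if "t \<in> ball \<theta> r" for t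
    proof -
      have t: "\<bar>t - \<theta>\<bar> < r" using that by (auto simp: dist_real_def)
      have "(\<lambda>k. complex_of_real (c k * (t - \<theta>) ^ k)) sums of_real (\<integral>y. exp (t * y) \<partial>M)"
        using c[of "t - \<theta>"] t by (intro sums_of_real) auto
      moreover have "(\<lambda>k. of_real (c k) * (of_real (t - \<theta>)) ^ k) sums F (of_real t)"
        using g(1)[of "of_real (t - \<theta>)"] t unfolding F_def
        by (metis norm_of_real of_real_diff)
      ultimately show ?thesis using sums_unique2 by fastforce
    qed
  qed
qed

text \<open>\<open>F\<close> is a positive real at \<open>\<theta>\<close>, so by continuity it
  avoids the branch cut of \<open>Ln\<close> on a smaller ball, and there \<open>Ln (F z)\<close>
  extends the cumulant generating function.\<close>

lemma cgf_locally_holomorphic: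
  assumes M: "real_distribution M" and \<theta>: "\<theta> \<in> interior (effective_domain M)"
  obtains r G where "r > 0" "G holomorphic_on ball (of_real \<theta>) r"
    "deriv G (of_real \<theta>) = of_real ((\<integral>y. y * exp (\<theta> * y) \<partial>M) / (\<integral>y. exp (\<theta> * y) \<partial>M))"
    "\<And>t. t \<in> ball \<theta> r \<Longrightarrow> cgf M t = Re (G (of_real t))"
proof -
  obtain r F where F: "r > 0" "F holomorphic_on ball (of_real \<theta>) r" "ball \<theta> r \<subseteq> effective_domain M"
    "deriv F (of_real \<theta>) = of_real (\<integral>y. y * exp (\<theta> * y) \<partial>M)"
    "\<And>t. t \<in> ball \<theta> r \<Longrightarrow> F (of_real t) = of_real (\<integral>y. exp (t * y) \<partial>M)"
    by (rule exp_integral_locally_holomorphic[OF M \<theta>]) (rule that)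
  have pos: "(\<integral>y. exp (t * y) \<partial>M) > 0" if "t \<in> ball \<theta> r" for t
    using that F(3) exp_integral_pos[OF M] effective_domain_iff[OF M] by blast
  have "continuous_on (ball (of_real \<theta>) r) F"
    by (rule holomorphic_on_imp_continuous_on[OF F(2)])
  then have "open (F -` (- \<real>\<^sub>\<le>\<^sub>0) \<inter> ball (of_real \<theta>) r)"
    by (intro continuous_on_open_vimage[THEN iffD1, rule_format])
       (auto simp: closed_nonpos_Reals_complex)
  moreover have "of_real \<theta> \<in> F -` (- \<real>\<^sub>\<le>\<^sub>0) \<inter> ball (of_real \<theta>) r"
    using F(1) F(5)[of \<theta>] pos[of \<theta>] by (auto simp: complex_nonpos_Reals_iff)
  ultimately obtain q where q: "q > 0" "ball (of_real \<theta>) q \<subseteq> F -` (- \<real>\<^sub>\<le>\<^sub>0) \<inter> ball (of_real \<theta>) r"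
    by (meson open_contains_ball)
  have F': "(F has_field_derivative of_real (\<integral>y. y * exp (\<theta> * y) \<partial>M)) (at (of_real \<theta>))"
    using holomorphic_derivI[OF F(2) open_ball, where x = "of_real \<theta>" and T = UNIV] F(1,4) by simp
  show ?thesis
  proof
    show "min q r > 0" using q F by simp
    show "(\<lambda>z. Ln (F z)) holomorphic_on ball (of_real \<theta>) (min q r)"
      by (rule holomorphic_on_Ln')
         (use q(2) in \<open>auto intro!: holomorphic_on_subset[OF F(2)]\<close>)
    have "F (of_real \<theta>) \<notin> \<real>\<^sub>\<le>\<^sub>0"
      using q centre_in_ball by blast
    then have "((\<lambda>z. Ln (F z)) has_field_derivative
        of_real (\<integral>y. y * exp (\<theta> * y) \<partial>M) / F (of_real \<theta>)) (at (of_real \<theta>))"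
      using DERIV_chain2[OF has_field_derivative_Ln F'] by (simp add: field_simps)
    then show "deriv (\<lambda>z. Ln (F z)) (of_real \<theta>)
        = of_real ((\<integral>y. y * exp (\<theta> * y) \<partial>M) / (\<integral>y. exp (\<theta> * y) \<partial>M))"
      using F(1) F(5)[of \<theta>] by (simp add: DERIV_imp_deriv)
    show "cgf M t = Re (Ln (F (of_real t)))" if "t \<in> ball \<theta> (min q r)" for t
      using that cgf_eq[OF M, of t] F(3) F(5)[of t] pos[of t] by (auto simp: Ln_of_real)
  qed
qed

text \<open>Taking real parts commutes with differentiation along the real axis. The two claims are
  proved together: differentiability at order \<open>k\<close> is what evaluates the next
  \<open>deriv\<close> on the whole ball.\<close>

lemma higher_deriv_Re_holomorphic:
  assumes G: "G holomorphic_on ball (of_real \<theta>) r"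
    and f: "\<And>t. t \<in> ball \<theta> r \<Longrightarrow> f t = Re (G (of_real t))" and t: "t \<in> ball \<theta> r"
  shows "(deriv ^^ k) f t = Re ((deriv ^^ k) G (of_real t)) \<and>
    ((deriv ^^ k) f has_real_derivative Re ((deriv ^^ Suc k) G (of_real t))) (at t)"
  using t
proof (induction k arbitrary: t)
  have step: "(g has_real_derivative Re ((deriv ^^ Suc k) G (of_real t))) (at t)"
    if t: "t \<in> ball \<theta> r" and g: "\<And>t. t \<in> ball \<theta> r \<Longrightarrow> g t = Re ((deriv ^^ k) G (of_real t))"
    for k t and g :: "real \<Rightarrow> real"
  proof -
    have "of_real t \<in> ball (complex_of_real \<theta>) r"
      using t by (simp add: dist_of_real)
    then have "((deriv ^^ k) G has_field_derivative (deriv ^^ Suc k) G (of_real t)) (at (of_real t))"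
      using holomorphic_derivI[OF holomorphic_higher_deriv[OF G open_ball], of "of_real t" k UNIV] by simp
    then have "((\<lambda>t. (deriv ^^ k) G (of_real t)) has_vector_derivative (deriv ^^ Suc k) G (of_real t)) (at t)"
      by (rule has_vector_derivative_real_field)
    then have "((\<lambda>t. Re ((deriv ^^ k) G (of_real t))) has_real_derivative Re ((deriv ^^ Suc k) G (of_real t))) (at t)"
      by (rule has_field_derivative_Re)
    then show ?thesis
      by (rule has_field_derivative_transform_within_open[OF _ open_ball t]) (simp add: g)
  qed
  { case 0
    then show ?case using f step[of t f 0] by simp
  next
    case (Suc k)
    have "deriv ((deriv ^^ k) f) s = Re ((deriv ^^ Suc k) G (of_real s))" if "s \<in> ball \<theta> r" for s
      using Suc.IH[OF that] DERIV_imp_deriv by blast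
    then show ?case
      using step[OF Suc.prems, of "(deriv ^^ Suc k) f" "Suc k"] Suc.prems by simp }
qed

text \<open>Since \<open>deriv\<close> is a total operator, its iterates mean something only once
  every step is a genuine derivative; the local holomorphic extension supplies this at all
  orders.\<close>

lemma cgf_smooth:
  assumes "real_distribution M" and "\<theta> \<in> interior (effective_domain M)"
  shows "((deriv ^^ k) (cgf M) has_real_derivative (deriv ^^ Suc k) (cgf M) \<theta>) (at \<theta>)"
proof -
  obtain r G where G: "r > 0" "G holomorphic_on ball (of_real \<theta>) r"
    "\<And>t. t \<in> ball \<theta> r \<Longrightarrow> cgf M t = Re (G (of_real t))"
    using cgf_locally_holomorphic[OF assms] by blast
  show ?thesis
    using higher_deriv_Re_holomorphic[OF G(2,3), of \<theta> k] higher_deriv_Re_holomorphic[OF G(2,3), of \<theta> "Suc k"]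
      G(1) by auto
qed

text \<open>This turns the hypothesis on the mean of the limit distribution into a statement on the
  cumulant generating function at 0.\<close>

lemma deriv_cgf_0:
  assumes "real_distribution M" and "0 \<in> interior (effective_domain M)"
  shows "deriv (cgf M) 0 = (\<integral>y. y \<partial>M)"
proof -
  interpret real_distribution M by fact
  obtain r G where G: "r > 0" "G holomorphic_on ball (of_real 0) r"
    "deriv G (of_real 0) = of_real ((\<integral>y. y * exp (0 * y) \<partial>M) / (\<integral>y. exp (0 * y) \<partial>M))"
    "\<And>t. t \<in> ball 0 r \<Longrightarrow> cgf M t = Re (G (of_real t))"
    by (rule cgf_locally_holomorphic[OF assms]) (rule that)
  have "deriv (cgf M) 0 = Re (deriv G (of_real 0))"
    using higher_deriv_Re_holomorphic[OF G(2,4), of 0 1] G(1) by simp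
  then show ?thesis
    using G(3) prob_space by simp
qed

section \<open>Averages over segments\<close>

text \<open>The integral form involves no division, so it makes sense at \<open>x = a\<close>. The
  weight is left general: 1 gives increments, \<open>1 - t\<close> gives the second-order Taylor
  remainder, and each differentiation in \<open>x\<close> multiplies the weight by
  \<open>t\<close>.\<close>

definition seg_avg :: "(real \<Rightarrow> real) \<Rightarrow> real \<Rightarrow> (real \<Rightarrow> real) \<Rightarrow> real \<Rightarrow> real" where
  "seg_avg \<rho> a f x = integral {0..1} (\<lambda>t. \<rho> t * f (a + t * (x - a)))"

lemma segment_mem_convex:
  fixes a x t :: real
  assumes "convex D" "a \<in> D" "x \<in> D" "t \<in> {0..1}"
  shows "a + t * (x - a) \<in> D"
proof -
  have "(1 - t) *\<^sub>R a + t *\<^sub>R x \<in> D"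
    using assms by (intro convexD) auto
  then show ?thesis by (simp add: algebra_simps)
qed

lemma continuous_on_segment_param:
  fixes a :: real and f \<rho> :: "real \<Rightarrow> real"
  assumes D: "convex D" "a \<in> D" and "continuous_on D f" "continuous_on {0..1} \<rho>"
  shows "continuous_on (D \<times> {0..1}) (\<lambda>(x, t). \<rho> t * f (a + t * (x - a)))"
  unfolding split_def
  by (intro continuous_intros continuous_on_compose2[OF assms(3)] continuous_on_compose2[OF assms(4)])
     (use segment_mem_convex[OF D] in auto)

lemma continuous_on_segment:
  fixes a x :: real and f \<rho> :: "real \<Rightarrow> real"
  assumes "convex D" "a \<in> D" "x \<in> D" "continuous_on D f" "continuous_on {0..1} \<rho>"
  shows "continuous_on {0..1} (\<lambda>t. \<rho> t * f (a + t * (x - a)))"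
  using segment_mem_convex[OF assms(1-3)]
  by (intro continuous_intros continuous_on_compose2[OF assms(4)] continuous_on_compose2[OF assms(5)]) auto

lemma continuous_on_seg_avg:
  fixes a :: real and f \<rho> :: "real \<Rightarrow> real"
  assumes "convex D" "a \<in> D" "continuous_on D f" "continuous_on {0..1} \<rho>"
  shows "continuous_on D (seg_avg \<rho> a f)"
  using integral_continuous_on_param[of D 0 1 "\<lambda>x t. \<rho> t * f (a + t * (x - a))"]
    continuous_on_segment_param[OF assms] by (simp add: seg_avg_def[abs_def])

lemma seg_avg_lower_bound:
  assumes "convex D" "a \<in> D" "x \<in> D" "continuous_on D f" "continuous_on {0..1} \<rho>"
    and "\<And>t. t \<in> {0..1} \<Longrightarrow> \<rho> t \<ge> 0" "\<And>x. x \<in> D \<Longrightarrow> c \<le> f x"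
  shows "c * integral {0..1} \<rho> \<le> seg_avg \<rho> a f x"
proof -
  have "c * integral {0..1} \<rho> = integral {0..1} (\<lambda>t. \<rho> t * c)"
    by (simp add: mult.commute)
  also have "\<dots> \<le> seg_avg \<rho> a f x"
    unfolding seg_avg_def
  proof (intro integral_le integrable_continuous_real continuous_on_segment[OF assms(1-5)])
    show "continuous_on {0..1} (\<lambda>t. \<rho> t * c)" using assms(5) by (intro continuous_intros)
    show "\<rho> t * c \<le> \<rho> t * f (a + t * (x - a))" if "t \<in> {0..1}" for t
      using that assms(6,7) segment_mem_convex[OF assms(1-3)] by (intro mult_left_mono) auto
  qed
  finally show ?thesis .
qed

lemma integral_one_minus: "integral {0..1} (\<lambda>t. 1 - t) = (1 / 2 :: real)"
proof -
  have "((\<lambda>t. 1 - t) has_integral (1 - 1\<^sup>2 / 2) - (0 - 0\<^sup>2 / 2)) {0..1::real}"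
    by (rule fundamental_theorem_of_calculus)
       (auto intro!: derivative_eq_intros simp flip: has_real_derivative_iff_has_vector_derivative)
  then show ?thesis
    by (simp add: integral_unique)
qed

text \<open>The fundamental theorem of calculus along the parametrised segment.\<close>

lemma seg_avg_of_deriv:
  assumes "convex D" "a \<in> D" "x \<in> D" "\<And>x. x \<in> D \<Longrightarrow> (f has_real_derivative f' x) (at x)"
  shows "f x - f a = (x - a) * seg_avg (\<lambda>t. 1) a f' x"
proof -
  have "((\<lambda>t. (x - a) * (1 * f' (a + t * (x - a)))) has_integral f (a + 1 * (x - a)) - f (a + 0 * (x - a))) {0..1}"
  proof (rule fundamental_theorem_of_calculus)
    fix t :: real assume "t \<in> {0..1}"
    then have "(f has_real_derivative f' (a + t * (x - a))) (at (a + t * (x - a)))"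
      using assms segment_mem_convex by blast
    then have "((\<lambda>t. f (a + t * (x - a))) has_real_derivative f' (a + t * (x - a)) * (x - a)) (at t within {0..1})"
      by (rule DERIV_chain2) (auto intro!: derivative_eq_intros)
    then show "((\<lambda>t. f (a + t * (x - a))) has_vector_derivative (x - a) * (1 * f' (a + t * (x - a)))) (at t within {0..1})"
      by (simp add: has_real_derivative_iff_has_vector_derivative mult.commute)
  qed simp
  from integral_unique[OF this] show ?thesis
    by (simp add: seg_avg_def)
qed

lemma seg_avg_Taylor:
  assumes "convex D" "a \<in> D" "x \<in> D" "\<And>x. x \<in> D \<Longrightarrow> (f has_real_derivative f' x) (at x)"
    and "\<And>x. x \<in> D \<Longrightarrow> (f' has_real_derivative f'' x) (at x)"
  shows "f x - f a - (x - a) * f' a = (x - a)\<^sup>2 * seg_avg (\<lambda>t. 1 - t) a f'' x"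
proof -
  \<comment> \<open>This is the antiderivative behind the integral remainder: by the product rule
    its \<open>f'\<close> terms cancel, and its end values are \<open>f x\<close> and
    \<open>f a + (x - a) * f' a\<close>.\<close>
  let ?\<phi> = "\<lambda>t. (1 - t) * (x - a) * f' (a + t * (x - a)) + f (a + t * (x - a))"
  have "((\<lambda>t. (x - a)\<^sup>2 * ((1 - t) * f'' (a + t * (x - a)))) has_integral ?\<phi> 1 - ?\<phi> 0) {0..1}"
  proof (rule fundamental_theorem_of_calculus)
    fix t :: real assume t: "t \<in> {0..1}"
    then have "(f has_real_derivative f' (a + t * (x - a))) (at (a + t * (x - a)))"
      using assms segment_mem_convex by blast
    then have 1: "((\<lambda>t. f (a + t * (x - a))) has_real_derivative f' (a + t * (x - a)) * (x - a)) (at t within {0..1})"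
      by (rule DERIV_chain2) (auto intro!: derivative_eq_intros)
    have "(f' has_real_derivative f'' (a + t * (x - a))) (at (a + t * (x - a)))"
      using t assms segment_mem_convex by blast
    then have 2: "((\<lambda>t. f' (a + t * (x - a))) has_real_derivative f'' (a + t * (x - a)) * (x - a)) (at t within {0..1})"
      by (rule DERIV_chain2) (auto intro!: derivative_eq_intros)
    have "(?\<phi> has_real_derivative (x - a)\<^sup>2 * ((1 - t) * f'' (a + t * (x - a)))) (at t within {0..1})"
      by (rule derivative_eq_intros 1 2 refl)+ (simp add: power2_eq_square algebra_simps)
    then show "(?\<phi> has_vector_derivative (x - a)\<^sup>2 * ((1 - t) * f'' (a + t * (x - a)))) (at t within {0..1})"
      by (simp add: has_real_derivative_iff_has_vector_derivative)
  qed simp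
  from integral_unique[OF this] show ?thesis
    by (simp add: seg_avg_def)
qed

lemma deriv_lower_bound_imp_increment:
  fixes f :: "real \<Rightarrow> real"
  assumes "a \<le> b" "\<And>x. a \<le> x \<Longrightarrow> x \<le> b \<Longrightarrow> (f has_real_derivative f' x) (at x)"
    and "\<And>x. a \<le> x \<Longrightarrow> x \<le> b \<Longrightarrow> c \<le> f' x"
  shows "c * (b - a) \<le> f b - f a"
proof -
  have "(\<lambda>x. f x - c * x) a \<le> (\<lambda>x. f x - c * x) b"
  proof (rule DERIV_nonneg_imp_nondecreasing[OF assms(1)])
    fix x assume "a \<le> x" "x \<le> b"
    then show "\<exists>y. ((\<lambda>x. f x - c * x) has_real_derivative y) (at x) \<and> 0 \<le> y"
      using assms(2,3) by (intro exI[of _ "f' x - c"]) (auto intro!: derivative_eq_intros)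
  qed
  then show ?thesis by (simp add: algebra_simps)
qed

section \<open>Families whose derivatives gain powers of the parameter\<close>

text \<open>\<^term>\<open>scaled S n r f\<close>: for \<open>k \<le> n\<close> the \<open>k\<close>-th derivative of \<open>f \<epsilon>\<close> is \<open>O(\<epsilon>\<^sup>r\<^sup>+\<^sup>k)\<close>, uniformly on \<open>S \<epsilon>\<close>.\<close>
primrec scaled :: "(real \<Rightarrow> real set) \<Rightarrow> nat \<Rightarrow> nat \<Rightarrow> (real \<Rightarrow> real \<Rightarrow> real) \<Rightarrow> bool" where
  "scaled S 0 r f \<longleftrightarrow> (\<exists>C. \<forall>\<^sub>F \<epsilon> in at_right 0. \<forall>x\<in>S \<epsilon>. \<bar>f \<epsilon> x\<bar> \<le> C * \<epsilon> ^ r)"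
| "scaled S (Suc n) r f \<longleftrightarrow>
    (\<exists>C. \<forall>\<^sub>F \<epsilon> in at_right 0. \<forall>x\<in>S \<epsilon>. \<bar>f \<epsilon> x\<bar> \<le> C * \<epsilon> ^ r) \<and>
    (\<exists>f'. (\<forall>\<^sub>F \<epsilon> in at_right 0. \<forall>x\<in>S \<epsilon>. (f \<epsilon> has_real_derivative f' \<epsilon> x) (at x)) \<and>
      scaled S n (Suc r) f')"

section \<open>Elementary rules for the scaling predicate\<close>

lemma scaled_SucI:
  assumes "scaled S 0 r f"
    and "\<forall>\<^sub>F \<epsilon> in at_right 0. \<forall>x\<in>S \<epsilon>. (f \<epsilon> has_real_derivative f' \<epsilon> x) (at x)"
    and "scaled S n (Suc r) f'"
  shows "scaled S (Suc n) r f"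
  using assms by auto

lemma scaled_SucE:
  assumes "scaled S (Suc n) r f"
  obtains f' where "\<forall>\<^sub>F \<epsilon> in at_right 0. \<forall>x\<in>S \<epsilon>. (f \<epsilon> has_real_derivative f' \<epsilon> x) (at x)"
    and "scaled S n (Suc r) f'"
  using assms by auto

lemma scaled_0: "scaled S n r f \<Longrightarrow> scaled S 0 r f"
  by (cases n) auto

lemma scaled_SucD: "scaled S (Suc n) r f \<Longrightarrow> scaled S n r f"
proof (induction n arbitrary: r f)
  case 0
  then show ?case by auto
next
  case (Suc n)
  from Suc.prems obtain f' where
    "\<forall>\<^sub>F \<epsilon> in at_right 0. \<forall>x\<in>S \<epsilon>. (f \<epsilon> has_real_derivative f' \<epsilon> x) (at x)" "scaled S (Suc n) (Suc r) f'"
    by (rule scaled_SucE)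
  then show ?case
    using scaled_0[OF Suc.prems] Suc.IH by (intro scaled_SucI)
qed

lemma scaled_boundE:
  assumes "scaled S n r f"
  obtains C where "C > 0" "\<forall>\<^sub>F \<epsilon> in at_right 0. \<forall>x\<in>S \<epsilon>. \<bar>f \<epsilon> x\<bar> \<le> C * \<epsilon> ^ r"
proof -
  obtain C where C: "\<forall>\<^sub>F \<epsilon> in at_right 0. \<forall>x\<in>S \<epsilon>. \<bar>f \<epsilon> x\<bar> \<le> C * \<epsilon> ^ r"
    using scaled_0[OF assms] by auto
  have "\<forall>\<^sub>F \<epsilon> in at_right 0. \<forall>x\<in>S \<epsilon>. \<bar>f \<epsilon> x\<bar> \<le> max C 1 * \<epsilon> ^ r"
    using C eventually_at_right_less[of 0]
  proof eventually_elim
    case (elim \<epsilon>)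
    then have "C * \<epsilon> ^ r \<le> max C 1 * \<epsilon> ^ r" by (intro mult_right_mono) auto
    then show ?case using elim(1) by (blast intro: order_trans)
  qed
  then show ?thesis using that[of "max C 1"] by simp
qed

text \<open>On an open set two functions that agree have the same derivatives, so the witness
  \<open>f'\<close> serves for both and no induction is required.\<close>

lemma scaled_cong:
  assumes S: "\<forall>\<^sub>F \<epsilon> in at_right 0. open (S \<epsilon>)" and eq: "\<forall>\<^sub>F \<epsilon> in at_right 0. \<forall>x\<in>S \<epsilon>. f \<epsilon> x = g \<epsilon> x"
    and f: "scaled S n r f"
  shows "scaled S n r g"
proof -
  obtain C where C: "C > 0" "\<forall>\<^sub>F \<epsilon> in at_right 0. \<forall>x\<in>S \<epsilon>. \<bar>f \<epsilon> x\<bar> \<le> C * \<epsilon> ^ r"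
    using scaled_boundE[OF f] by blast
  have "\<forall>\<^sub>F \<epsilon> in at_right 0. \<forall>x\<in>S \<epsilon>. \<bar>g \<epsilon> x\<bar> \<le> C * \<epsilon> ^ r"
    using C(2) eq by eventually_elim auto
  then have 0: "scaled S 0 r g" by auto
  show ?thesis
  proof (cases n)
    case (Suc k)
    obtain f' where f': "\<forall>\<^sub>F \<epsilon> in at_right 0. \<forall>x\<in>S \<epsilon>. (f \<epsilon> has_real_derivative f' \<epsilon> x) (at x)" "scaled S k (Suc r) f'"
      using f unfolding Suc by (rule scaled_SucE)
    have "\<forall>\<^sub>F \<epsilon> in at_right 0. \<forall>x\<in>S \<epsilon>. (g \<epsilon> has_real_derivative f' \<epsilon> x) (at x)"
      using f'(1) eq S
    proof eventually_elim
      case (elim \<epsilon>)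
      show ?case
      proof
        fix x assume x: "x \<in> S \<epsilon>"
        then have "(f \<epsilon> has_real_derivative f' \<epsilon> x) (at x)" using elim by blast
        then show "(g \<epsilon> has_real_derivative f' \<epsilon> x) (at x)"
          by (rule has_field_derivative_transform_within_open[OF _ elim(3) x]) (use elim in auto)
      qed
    qed
    then show ?thesis unfolding Suc using 0 f'(2) by (rule_tac scaled_SucI)
  qed (use 0 in blast)
qed

section \<open>Closure under sums, products and composition\<close>

lemma scaled_mult_0:
  assumes "scaled S n r f" "scaled S m s g"
  shows "scaled S 0 (r + s) (\<lambda>\<epsilon> x. f \<epsilon> x * g \<epsilon> x)"
proof -
  obtain C where C: "C > 0" "\<forall>\<^sub>F \<epsilon> in at_right 0. \<forall>x\<in>S \<epsilon>. \<bar>f \<epsilon> x\<bar> \<le> C * \<epsilon> ^ r"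
    using scaled_boundE[OF assms(1)] by blast
  obtain D where D: "D > 0" "\<forall>\<^sub>F \<epsilon> in at_right 0. \<forall>x\<in>S \<epsilon>. \<bar>g \<epsilon> x\<bar> \<le> D * \<epsilon> ^ s"
    using scaled_boundE[OF assms(2)] by blast
  have "\<forall>\<^sub>F \<epsilon> in at_right 0. \<forall>x\<in>S \<epsilon>. \<bar>f \<epsilon> x * g \<epsilon> x\<bar> \<le> (C * D) * \<epsilon> ^ (r + s)"
    using C(2) D(2) eventually_at_right_less[of 0]
  proof eventually_elim
    case (elim \<epsilon>)
    have "\<bar>f \<epsilon> x * g \<epsilon> x\<bar> \<le> (C * \<epsilon> ^ r) * (D * \<epsilon> ^ s)" if "x \<in> S \<epsilon>" for x
      unfolding abs_mult using elim that C(1) by (intro mult_mono) auto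
    then show ?case by (simp add: power_add mult_ac)
  qed
  then show ?thesis by auto
qed

lemma scaled_add:
  assumes "scaled S n r f" "scaled S n r g"
  shows "scaled S n r (\<lambda>\<epsilon> x. f \<epsilon> x + g \<epsilon> x)"
  using assms
proof (induction n arbitrary: r f g)
  have *: "scaled S 0 r (\<lambda>\<epsilon> x. f \<epsilon> x + g \<epsilon> x)" if f: "scaled S n r f" and g: "scaled S n r g" for n r f g
  proof -
    obtain C where C: "C > 0" "\<forall>\<^sub>F \<epsilon> in at_right 0. \<forall>x\<in>S \<epsilon>. \<bar>f \<epsilon> x\<bar> \<le> C * \<epsilon> ^ r"
      using scaled_boundE[OF f] by blast
    obtain D where D: "D > 0" "\<forall>\<^sub>F \<epsilon> in at_right 0. \<forall>x\<in>S \<epsilon>. \<bar>g \<epsilon> x\<bar> \<le> D * \<epsilon> ^ r"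
      using scaled_boundE[OF g] by blast
    have "\<forall>\<^sub>F \<epsilon> in at_right 0. \<forall>x\<in>S \<epsilon>. \<bar>f \<epsilon> x + g \<epsilon> x\<bar> \<le> (C + D) * \<epsilon> ^ r"
      using C(2) D(2) by eventually_elim (force simp: distrib_right)
    then show ?thesis by auto
  qed
  { case 0
    then show ?case by (rule *)
  next
    case (Suc n)
    obtain f' where f': "\<forall>\<^sub>F \<epsilon> in at_right 0. \<forall>x\<in>S \<epsilon>. (f \<epsilon> has_real_derivative f' \<epsilon> x) (at x)" "scaled S n (Suc r) f'"
      using Suc.prems(1) by (rule scaled_SucE)
    obtain g' where g': "\<forall>\<^sub>F \<epsilon> in at_right 0. \<forall>x\<in>S \<epsilon>. (g \<epsilon> has_real_derivative g' \<epsilon> x) (at x)" "scaled S n (Suc r) g'"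
      using Suc.prems(2) by (rule scaled_SucE)
    have "\<forall>\<^sub>F \<epsilon> in at_right 0. \<forall>x\<in>S \<epsilon>.
        ((\<lambda>x. f \<epsilon> x + g \<epsilon> x) has_real_derivative f' \<epsilon> x + g' \<epsilon> x) (at x)"
      using f'(1) g'(1) by eventually_elim (auto intro: DERIV_add)
    then show ?case
      using *[OF Suc.prems] Suc.IH[OF f'(2) g'(2)] by (intro scaled_SucI) }
qed

text \<open>In the Leibniz rule exactly one factor of each summand is differentiated, so both
  summands gain one power of the parameter.\<close>

lemma scaled_mult:
  assumes "scaled S n r f" "scaled S n s g"
  shows "scaled S n (r + s) (\<lambda>\<epsilon> x. f \<epsilon> x * g \<epsilon> x)"
  using assms
proof (induction n arbitrary: r f s g)
  case 0
  then show ?case by (rule scaled_mult_0)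
next
  case (Suc n)
  obtain f' where f': "\<forall>\<^sub>F \<epsilon> in at_right 0. \<forall>x\<in>S \<epsilon>. (f \<epsilon> has_real_derivative f' \<epsilon> x) (at x)" "scaled S n (Suc r) f'"
    using Suc.prems(1) by (rule scaled_SucE)
  obtain g' where g': "\<forall>\<^sub>F \<epsilon> in at_right 0. \<forall>x\<in>S \<epsilon>. (g \<epsilon> has_real_derivative g' \<epsilon> x) (at x)" "scaled S n (Suc s) g'"
    using Suc.prems(2) by (rule scaled_SucE)
  have "\<forall>\<^sub>F \<epsilon> in at_right 0. \<forall>x\<in>S \<epsilon>.
      ((\<lambda>x. f \<epsilon> x * g \<epsilon> x) has_real_derivative f' \<epsilon> x * g \<epsilon> x + f \<epsilon> x * g' \<epsilon> x) (at x)"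
    using f'(1) g'(1) by eventually_elim (auto intro!: derivative_eq_intros)
  moreover have "scaled S n (Suc (r + s)) (\<lambda>\<epsilon> x. f' \<epsilon> x * g \<epsilon> x + f \<epsilon> x * g' \<epsilon> x)"
    using scaled_add[OF Suc.IH[OF f'(2) scaled_SucD[OF Suc.prems(2)]]] Suc.IH[OF scaled_SucD[OF Suc.prems(1)] g'(2)]
    by simp
  ultimately show ?case
    by (rule scaled_SucI[OF scaled_mult_0[OF Suc.prems]])
qed

lemma scaled_const: "scaled S n 0 (\<lambda>\<epsilon> x. c)"
proof -
  \<comment> \<open>The zero family has every exponent; the derivative of a constant is used with
    exponent 1.\<close>
  have 0: "scaled S m s (\<lambda>\<epsilon> x. 0)" for m s
    by (induction m arbitrary: s)
       (auto intro!: exI[of _ 0] exI[of _ "\<lambda>\<epsilon> x. 0"])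
  show ?thesis
    by (cases n) (use 0 in \<open>auto intro!: exI[of _ "\<bar>c\<bar>"] exI[of _ "\<lambda>\<epsilon> x. 0"]\<close>)
qed

lemma scaled_compose_0:
  assumes "\<forall>\<^sub>F \<epsilon> in at_right 0. g \<epsilon> ` S \<epsilon> \<subseteq> T \<epsilon>" "scaled T n r f"
  shows "scaled S 0 r (\<lambda>\<epsilon> x. f \<epsilon> (g \<epsilon> x))"
proof -
  obtain C where C: "C > 0" "\<forall>\<^sub>F \<epsilon> in at_right 0. \<forall>x\<in>T \<epsilon>. \<bar>f \<epsilon> x\<bar> \<le> C * \<epsilon> ^ r"
    using scaled_boundE[OF assms(2)] by blast
  have "\<forall>\<^sub>F \<epsilon> in at_right 0. \<forall>x\<in>S \<epsilon>. \<bar>f \<epsilon> (g \<epsilon> x)\<bar> \<le> C * \<epsilon> ^ r"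
    using C(2) assms(1) by eventually_elim auto
  then show ?thesis by auto
qed

text \<open>By the chain rule the extra power comes from the outer derivative \<open>f'\<close>,
  while \<open>g'\<close> contributes exponent 0. Control of \<open>g'\<close> to order
  \<open>n\<close> suffices for order \<open>Suc n\<close> of the composition, a gain that
  bootstrapping arguments can use.\<close>

lemma scaled_compose:
  assumes maps: "\<forall>\<^sub>F \<epsilon> in at_right 0. g \<epsilon> ` S \<epsilon> \<subseteq> T \<epsilon>"
    and g: "\<forall>\<^sub>F \<epsilon> in at_right 0. \<forall>x\<in>S \<epsilon>. (g \<epsilon> has_real_derivative g' \<epsilon> x) (at x)"
    and g': "scaled S n 0 g'" and f: "scaled T (Suc n) r f"
  shows "scaled S (Suc n) r (\<lambda>\<epsilon> x. f \<epsilon> (g \<epsilon> x))"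
  using g' f
proof (induction n arbitrary: r f)
  have deriv: "\<forall>\<^sub>F \<epsilon> in at_right 0. \<forall>x\<in>S \<epsilon>.
      ((\<lambda>x. f \<epsilon> (g \<epsilon> x)) has_real_derivative f' \<epsilon> (g \<epsilon> x) * g' \<epsilon> x) (at x)"
    if "\<forall>\<^sub>F \<epsilon> in at_right 0. \<forall>x\<in>T \<epsilon>. (f \<epsilon> has_real_derivative f' \<epsilon> x) (at x)" for f f'
    using that maps g
  proof eventually_elim
    case (elim \<epsilon>)
    show ?case
    proof
      fix x assume "x \<in> S \<epsilon>"
      then show "((\<lambda>x. f \<epsilon> (g \<epsilon> x)) has_real_derivative f' \<epsilon> (g \<epsilon> x) * g' \<epsilon> x) (at x)"
        using elim by (intro DERIV_chain2[of "f \<epsilon>"]) auto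
    qed
  qed
  { case 0
    obtain f' where f': "\<forall>\<^sub>F \<epsilon> in at_right 0. \<forall>x\<in>T \<epsilon>. (f \<epsilon> has_real_derivative f' \<epsilon> x) (at x)" "scaled T 0 (Suc r) f'"
      using 0(2) by (rule scaled_SucE)
    show ?case
      by (rule scaled_SucI[OF scaled_compose_0[OF maps 0(2)] deriv[OF f'(1)]])
         (use scaled_mult_0[OF scaled_compose_0[OF maps f'(2)] 0(1)] in simp)
  next
    case (Suc n)
    obtain f' where f': "\<forall>\<^sub>F \<epsilon> in at_right 0. \<forall>x\<in>T \<epsilon>. (f \<epsilon> has_real_derivative f' \<epsilon> x) (at x)" "scaled T (Suc n) (Suc r) f'"
      using Suc.prems(2) by (rule scaled_SucE)
    show ?case
      by (rule scaled_SucI[OF scaled_compose_0[OF maps Suc.prems(2)] deriv[OF f'(1)]])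
         (use scaled_mult[OF Suc.IH[OF scaled_SucD[OF Suc.prems(1)] f'(2)] Suc.prems(1)] in simp) }
qed

lemma scaled_compose':
  assumes "\<forall>\<^sub>F \<epsilon> in at_right 0. g \<epsilon> ` S \<epsilon> \<subseteq> T \<epsilon>"
    and "\<forall>\<^sub>F \<epsilon> in at_right 0. \<forall>x\<in>S \<epsilon>. (g \<epsilon> has_real_derivative g' \<epsilon> x) (at x)"
    and "scaled S n 0 g'" and "scaled T n r f"
  shows "scaled S n r (\<lambda>\<epsilon> x. f \<epsilon> (g \<epsilon> x))"
proof (cases n)
  case 0
  then show ?thesis using scaled_compose_0 assms(1,4) by blast
next
  case (Suc k)
  then show ?thesis using scaled_compose[OF assms(1,2)] assms(3,4) scaled_SucD by blast
qed

text \<open>A bootstrap for the equation \<open>g' = q(g)\<close>: control of \<open>q(g)\<close> to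
  order \<open>n\<close> is control of \<open>g'\<close>, and the composition rule then gives order
  \<open>Suc n\<close>. Inverse functions satisfy such an equation, with \<open>q\<close> the
  reciprocal of the original derivative.\<close>

lemma scaled_inverse_function:
  assumes maps: "\<forall>\<^sub>F \<epsilon> in at_right 0. g \<epsilon> ` S \<epsilon> \<subseteq> T \<epsilon>"
    and g: "\<forall>\<^sub>F \<epsilon> in at_right 0. \<forall>x\<in>S \<epsilon>. (g \<epsilon> has_real_derivative q \<epsilon> (g \<epsilon> x)) (at x)"
    and q: "\<And>n. scaled T n 0 q"
  shows "scaled S n 0 (\<lambda>\<epsilon> x. q \<epsilon> (g \<epsilon> x))"
proof (induction n)
  case 0
  show ?case by (rule scaled_compose_0[OF maps q])
next
  case (Suc n)
  show ?case by (rule scaled_compose[OF maps g Suc q])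
qed

section \<open>Reciprocals, square roots, iterated derivatives and averages\<close>

text \<open>The derivative is \<open>- f' / f\<^sup>2\<close>. Its power of the parameter comes from
  \<open>f'\<close>, and the uniform lower bound keeps the remaining factors bounded.\<close>

lemma scaled_inverse:
  assumes c: "c > 0" "\<forall>\<^sub>F \<epsilon> in at_right 0. \<forall>x\<in>S \<epsilon>. f \<epsilon> x \<ge> c" and f: "scaled S n 0 f"
  shows "scaled S n 0 (\<lambda>\<epsilon> x. inverse (f \<epsilon> x))"
  using f
proof (induction n)
  have "\<forall>\<^sub>F \<epsilon> in at_right 0. \<forall>x\<in>S \<epsilon>. \<bar>inverse (f \<epsilon> x)\<bar> \<le> inverse c * \<epsilon> ^ 0"
    using c(2) by eventually_elim (use c(1) in \<open>force intro!: le_imp_inverse_le\<close>)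
  then have *: "scaled S 0 0 (\<lambda>\<epsilon> x. inverse (f \<epsilon> x))" by auto
  { case 0
    show ?case by (rule *)
  next
    case (Suc n)
    obtain f' where f': "\<forall>\<^sub>F \<epsilon> in at_right 0. \<forall>x\<in>S \<epsilon>. (f \<epsilon> has_real_derivative f' \<epsilon> x) (at x)" "scaled S n (Suc 0) f'"
      using Suc.prems by (rule scaled_SucE)
    have "\<forall>\<^sub>F \<epsilon> in at_right 0. \<forall>x\<in>S \<epsilon>. ((\<lambda>x. inverse (f \<epsilon> x)) has_real_derivative
        (-1) * (f' \<epsilon> x * (inverse (f \<epsilon> x) * inverse (f \<epsilon> x)))) (at x)"
      using f'(1) c(2)
    proof eventually_elim
      case (elim \<epsilon>)
      show ?case
      proof
        fix x assume x: "x \<in> S \<epsilon>"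
        then have "f \<epsilon> x \<noteq> 0" using elim c(1) by force
        then show "((\<lambda>x. inverse (f \<epsilon> x)) has_real_derivative
          (-1) * (f' \<epsilon> x * (inverse (f \<epsilon> x) * inverse (f \<epsilon> x)))) (at x)"
          using elim x by (auto intro!: derivative_eq_intros)
      qed
    qed
    moreover have i: "scaled S n 0 (\<lambda>\<epsilon> x. inverse (f \<epsilon> x))"
      by (rule Suc.IH[OF scaled_SucD[OF Suc.prems]])
    have "scaled S n (Suc 0) (\<lambda>\<epsilon> x. (-1) * (f' \<epsilon> x * (inverse (f \<epsilon> x) * inverse (f \<epsilon> x))))"
      using scaled_mult[OF scaled_const scaled_mult[OF f'(2) scaled_mult[OF i i]], of "-1"] by simp
    ultimately show ?case
      by (rule_tac scaled_SucI[OF *]) }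
qed

text \<open>The derivative is \<open>f' / (2 * sqrt f)\<close>; the induction hypothesis for the
  square root, combined with the rule for reciprocals, handles the denominator.\<close>

lemma scaled_sqrt:
  assumes c: "c > 0" "\<forall>\<^sub>F \<epsilon> in at_right 0. \<forall>x\<in>S \<epsilon>. f \<epsilon> x \<ge> c" and f: "scaled S n 0 f"
  shows "scaled S n 0 (\<lambda>\<epsilon> x. sqrt (f \<epsilon> x))"
  using f
proof (induction n)
  obtain C where C: "C > 0" "\<forall>\<^sub>F \<epsilon> in at_right 0. \<forall>x\<in>S \<epsilon>. \<bar>f \<epsilon> x\<bar> \<le> C * \<epsilon> ^ 0"
    using scaled_boundE[OF f] by blast
  have "\<forall>\<^sub>F \<epsilon> in at_right 0. \<forall>x\<in>S \<epsilon>. \<bar>sqrt (f \<epsilon> x)\<bar> \<le> sqrt C * \<epsilon> ^ 0"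
    using C(2) c(2) by eventually_elim (use c(1) in force)
  then have *: "scaled S 0 0 (\<lambda>\<epsilon> x. sqrt (f \<epsilon> x))" by auto
  { case 0
    show ?case by (rule *)
  next
    case (Suc n)
    obtain f' where f': "\<forall>\<^sub>F \<epsilon> in at_right 0. \<forall>x\<in>S \<epsilon>. (f \<epsilon> has_real_derivative f' \<epsilon> x) (at x)" "scaled S n (Suc 0) f'"
      using Suc.prems by (rule scaled_SucE)
    have "\<forall>\<^sub>F \<epsilon> in at_right 0. \<forall>x\<in>S \<epsilon>. ((\<lambda>x. sqrt (f \<epsilon> x)) has_real_derivative
        (1 / 2) * (f' \<epsilon> x * inverse (sqrt (f \<epsilon> x)))) (at x)"
      using f'(1) c(2)
    proof eventually_elim
      case (elim \<epsilon>)
      show ?case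
      proof
        fix x assume x: "x \<in> S \<epsilon>"
        then have "f \<epsilon> x > 0" using elim c(1) by force
        then show "((\<lambda>x. sqrt (f \<epsilon> x)) has_real_derivative
          (1 / 2) * (f' \<epsilon> x * inverse (sqrt (f \<epsilon> x)))) (at x)"
          using elim x by (auto intro!: derivative_eq_intros simp: field_simps)
      qed
    qed
    moreover have "\<forall>\<^sub>F \<epsilon> in at_right 0. \<forall>x\<in>S \<epsilon>. sqrt (f \<epsilon> x) \<ge> sqrt c"
      using c(2) by eventually_elim auto
    then have i: "scaled S n 0 (\<lambda>\<epsilon> x. inverse (sqrt (f \<epsilon> x)))"
      using c(1) Suc.IH[OF scaled_SucD[OF Suc.prems]] by (intro scaled_inverse[of "sqrt c"]) auto
    have "scaled S n (Suc 0) (\<lambda>\<epsilon> x. (1 / 2) * (f' \<epsilon> x * inverse (sqrt (f \<epsilon> x))))"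
      using scaled_mult[OF scaled_const scaled_mult[OF f'(2) i], of "1 / 2"] by simp
    ultimately show ?case
      by (rule_tac scaled_SucI[OF *]) }
qed

text \<open>The predicate only asserts that suitable derivatives exist. Uniqueness of derivatives on
  open sets identifies them with iterates of \<open>deriv\<close>, peeled off from the innermost
  one.\<close>

lemma scaled_higher_deriv:
  assumes S: "\<forall>\<^sub>F \<epsilon> in at_right 0. open (S \<epsilon>)" and f: "scaled S k r f"
  shows "\<exists>C. \<forall>\<^sub>F \<epsilon> in at_right 0. \<forall>x\<in>S \<epsilon>. \<bar>(deriv ^^ k) (f \<epsilon>) x\<bar> \<le> C * \<epsilon> ^ (r + k)"
  using f
proof (induction k arbitrary: r f)
  case 0
  then show ?case by simp
next
  case (Suc k)
  obtain f' where f': "\<forall>\<^sub>F \<epsilon> in at_right 0. \<forall>x\<in>S \<epsilon>. (f \<epsilon> has_real_derivative f' \<epsilon> x) (at x)" "scaled S k (Suc r) f'"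
    using Suc.prems by (rule scaled_SucE)
  have "\<forall>\<^sub>F \<epsilon> in at_right 0. \<forall>x\<in>S \<epsilon>. f' \<epsilon> x = deriv (f \<epsilon>) x"
    using f'(1) by eventually_elim (auto simp: DERIV_imp_deriv)
  then have "scaled S k (Suc r) (\<lambda>\<epsilon>. deriv (f \<epsilon>))"
    using scaled_cong[where S = S and f = f' and g = "\<lambda>\<epsilon>. deriv (f \<epsilon>)"] S f'(2) by blast
  from Suc.IH[OF this] show ?case
    by (simp add: funpow_swap1)
qed

text \<open>Differentiation under the integral replaces \<open>\<rho> t\<close> by
  \<open>\<rho> t * t\<close>, which is again bounded by 1 on the unit interval; hence the induction
  over all such weights. One order is given up because continuity of each integrand is drawn from
  its differentiability.\<close>

lemma scaled_average:
  assumes S: "\<And>\<epsilon>. open (S \<epsilon>)" "\<And>\<epsilon>. convex (S \<epsilon>)" and a: "\<forall>\<^sub>F \<epsilon> in at_right 0. a \<epsilon> \<in> S \<epsilon>"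
    and \<rho>: "continuous_on {0..1} \<rho>" "\<And>t. t \<in> {0..1} \<Longrightarrow> \<bar>\<rho> t\<bar> \<le> 1"
    and f: "scaled S (Suc n) r f"
  shows "scaled S n r (\<lambda>\<epsilon>. seg_avg \<rho> (a \<epsilon>) (f \<epsilon>))"
  unfolding seg_avg_def[abs_def] using \<rho> f
proof (induction n arbitrary: r f \<rho>)
  have seg: "a \<epsilon> + t * (x - a \<epsilon>) \<in> S \<epsilon>" if "a \<epsilon> \<in> S \<epsilon>" "x \<in> S \<epsilon>" "t \<in> {0..1}" for \<epsilon> t x
    using segment_mem_convex[OF S(2)] that by blast
  have cont: "continuous_on (S \<epsilon>) g" if "\<forall>x\<in>S \<epsilon>. (g has_real_derivative g' x) (at x)" for \<epsilon> g g'
    using that DERIV_isCont by (fastforce intro!: continuous_at_imp_continuous_on)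
  have cont1: "continuous_on {0..1} (\<lambda>t. \<rho> t * g (a \<epsilon> + t * (x - a \<epsilon>)))"
    if "a \<epsilon> \<in> S \<epsilon>" "\<forall>x\<in>S \<epsilon>. (g has_real_derivative g' x) (at x)" "continuous_on {0..1} \<rho>" "x \<in> S \<epsilon>"
    for \<epsilon> g g' \<rho> x
    by (rule continuous_on_segment[OF S(2) that(1,4) cont[OF that(2)] that(3)])
  have *: "scaled S 0 r (\<lambda>\<epsilon> x. integral {0..1} (\<lambda>t. \<rho> t * f \<epsilon> (a \<epsilon> + t * (x - a \<epsilon>))))"
    if \<rho>: "continuous_on {0..1} \<rho>" "\<And>t. t \<in> {0..1} \<Longrightarrow> \<bar>\<rho> t\<bar> \<le> 1" and f: "scaled S (Suc n) r f"
    for \<rho> n r f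
  proof -
    obtain C where C: "C > 0" "\<forall>\<^sub>F \<epsilon> in at_right 0. \<forall>x\<in>S \<epsilon>. \<bar>f \<epsilon> x\<bar> \<le> C * \<epsilon> ^ r"
      using scaled_boundE[OF f] by blast
    obtain f' where f': "\<forall>\<^sub>F \<epsilon> in at_right 0. \<forall>x\<in>S \<epsilon>. (f \<epsilon> has_real_derivative f' \<epsilon> x) (at x)" "scaled S n (Suc r) f'"
      using f by (rule scaled_SucE)
    have "\<forall>\<^sub>F \<epsilon> in at_right 0. \<forall>x\<in>S \<epsilon>.
        \<bar>integral {0..1} (\<lambda>t. \<rho> t * f \<epsilon> (a \<epsilon> + t * (x - a \<epsilon>)))\<bar> \<le> C * \<epsilon> ^ r"
      using C(2) f'(1) a eventually_at_right_less[of 0]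
    proof eventually_elim
      case (elim \<epsilon>)
      show ?case
      proof
        fix x assume x: "x \<in> S \<epsilon>"
        have "norm (\<rho> t * f \<epsilon> (a \<epsilon> + t * (x - a \<epsilon>))) \<le> C * \<epsilon> ^ r" if t: "t \<in> {0..1}" for t
        proof -
          have "\<bar>f \<epsilon> (a \<epsilon> + t * (x - a \<epsilon>))\<bar> \<le> C * \<epsilon> ^ r"
            using seg[OF _ x t] elim by blast
          then have "\<bar>\<rho> t\<bar> * \<bar>f \<epsilon> (a \<epsilon> + t * (x - a \<epsilon>))\<bar> \<le> 1 * (C * \<epsilon> ^ r)"
            using \<rho>(2)[OF t] by (intro mult_mono) auto
          then show ?thesis by (simp add: abs_mult)
        qed
        then show "\<bar>integral {0..1} (\<lambda>t. \<rho> t * f \<epsilon> (a \<epsilon> + t * (x - a \<epsilon>)))\<bar> \<le> C * \<epsilon> ^ r"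
          using integral_bound[OF _ cont1[OF elim(3) elim(2) \<rho>(1) x], of "C * \<epsilon> ^ r"] by simp
      qed
    qed
    then show ?thesis by auto
  qed
  { case 0
    show ?case by (rule *[OF 0])
  next
    case (Suc n)
    obtain f' where f': "\<forall>\<^sub>F \<epsilon> in at_right 0. \<forall>x\<in>S \<epsilon>. (f \<epsilon> has_real_derivative f' \<epsilon> x) (at x)" "scaled S (Suc n) (Suc r) f'"
      using Suc.prems(3) by (rule scaled_SucE)
    obtain f'' where f'': "\<forall>\<^sub>F \<epsilon> in at_right 0. \<forall>x\<in>S \<epsilon>. (f' \<epsilon> has_real_derivative f'' \<epsilon> x) (at x)"
      using f'(2) by (rule scaled_SucE)
    let ?\<rho> = "\<lambda>t. \<rho> t * t"
    have \<rho>': "continuous_on {0..1} ?\<rho>" "\<And>t. t \<in> {0..1} \<Longrightarrow> \<bar>?\<rho> t\<bar> \<le> 1"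
      using Suc.prems(1,2) by (auto intro!: continuous_intros mult_le_one simp: abs_mult)
    have "\<forall>\<^sub>F \<epsilon> in at_right 0. \<forall>x\<in>S \<epsilon>.
      ((\<lambda>x. integral {0..1} (\<lambda>t. \<rho> t * f \<epsilon> (a \<epsilon> + t * (x - a \<epsilon>)))) has_real_derivative
       integral {0..1} (\<lambda>t. ?\<rho> t * f' \<epsilon> (a \<epsilon> + t * (x - a \<epsilon>)))) (at x)"
      using f'(1) f'' a
    proof eventually_elim
      case (elim \<epsilon>)
      show ?case
      proof
        fix x assume x: "x \<in> S \<epsilon>"
        have "((\<lambda>x. integral (cbox 0 1) (\<lambda>t. \<rho> t * f \<epsilon> (a \<epsilon> + t * (x - a \<epsilon>)))) has_real_derivative
          integral (cbox 0 1) (\<lambda>t. ?\<rho> t * f' \<epsilon> (a \<epsilon> + t * (x - a \<epsilon>)))) (at x within S \<epsilon>)"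
        proof (rule leibniz_rule_field_derivative)
          fix x t :: real assume xt: "x \<in> S \<epsilon>" "t \<in> cbox 0 1"
          have "(f \<epsilon> has_real_derivative f' \<epsilon> (a \<epsilon> + t * (x - a \<epsilon>))) (at (a \<epsilon> + t * (x - a \<epsilon>)))"
            using seg[OF elim(3) xt(1)] xt(2) elim(1) by simp
          then have "((\<lambda>x. f \<epsilon> (a \<epsilon> + t * (x - a \<epsilon>))) has_real_derivative f' \<epsilon> (a \<epsilon> + t * (x - a \<epsilon>)) * t) (at x within S \<epsilon>)"
            by (rule DERIV_chain2) (auto intro!: derivative_eq_intros)
          then show "((\<lambda>x. \<rho> t * f \<epsilon> (a \<epsilon> + t * (x - a \<epsilon>))) has_real_derivative
             \<rho> t * t * f' \<epsilon> (a \<epsilon> + t * (x - a \<epsilon>))) (at x within S \<epsilon>)"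
            by (auto intro!: derivative_eq_intros)
        next
          show "(\<lambda>t. \<rho> t * f \<epsilon> (a \<epsilon> + t * (x - a \<epsilon>))) integrable_on cbox 0 1" if "x \<in> S \<epsilon>" for x
            using cont1[OF elim(3,1) Suc.prems(1) that] by (auto intro: integrable_continuous_real)
          show "continuous_on (S \<epsilon> \<times> cbox 0 1) (\<lambda>(x, t). \<rho> t * t * f' \<epsilon> (a \<epsilon> + t * (x - a \<epsilon>)))"
            using continuous_on_segment_param[OF S(2) elim(3) cont[OF elim(2)] \<rho>'(1)] by simp
        qed (use x S in auto)
        then show "((\<lambda>x. integral {0..1} (\<lambda>t. \<rho> t * f \<epsilon> (a \<epsilon> + t * (x - a \<epsilon>)))) has_real_derivative
          integral {0..1} (\<lambda>t. ?\<rho> t * f' \<epsilon> (a \<epsilon> + t * (x - a \<epsilon>)))) (at x)"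
          using at_within_open[OF x S(1)] by simp
      qed
    qed
    from scaled_SucI[OF *[OF Suc.prems] this Suc.IH[OF \<rho>' f'(2)]] show ?case . }
qed

section \<open>The change of variables at the saddlepoint\<close>

text \<open>The factor of \<open>(\<theta> - \<tau>)\<^sup>2\<close> in the second-order Taylor
  remainder at \<open>\<tau>\<close>, given a meaning at \<open>\<theta> = \<tau>\<close>
  too.\<close>

definition gap_avg :: "real measure \<Rightarrow> real \<Rightarrow> real \<Rightarrow> real" where
  "gap_avg M \<tau> = seg_avg (\<lambda>t. 1 - t) \<tau> ((deriv ^^ 2) (cgf M))"

text \<open>The difference quotient of the first derivative based at \<open>\<tau>\<close>, extended
  across \<open>\<tau>\<close>.\<close>

definition slope_avg :: "real measure \<Rightarrow> real \<Rightarrow> real \<Rightarrow> real" where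
  "slope_avg M \<tau> = seg_avg (\<lambda>t. 1) \<tau> ((deriv ^^ 2) (cgf M))"

definition w_deriv :: "real measure \<Rightarrow> real \<Rightarrow> real \<Rightarrow> real" where
  "w_deriv M \<tau> \<theta> = slope_avg M \<tau> \<theta> * inverse (sqrt (2 * gap_avg M \<tau> \<theta>))"

text \<open>The quotient of \<open>w_fun\<close> by \<open>\<theta>\<close>, extended across the
  zero of \<open>w_fun\<close> at 0.\<close>

definition w_quotient :: "real measure \<Rightarrow> real \<Rightarrow> real \<Rightarrow> real" where
  "w_quotient M \<tau> = seg_avg (\<lambda>t. 1) 0 (w_deriv M \<tau>)"

text \<open>One member of the family at a fixed parameter. The saddlepoint enters as a given
  solution \<open>\<tau>\<close> of its equation, so that the definite description in
  \<open>saddlepoint\<close> is resolved once inside the locale.\<close>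

locale strongly_convex_cgf =
  fixes M :: "real measure" and x \<delta> \<tau> :: real
  assumes M: "real_distribution M"
    and zero_in_domain: "0 \<in> interior (effective_domain M)"
    and \<delta>_pos: "\<delta> > 0"
    and deriv2_ge: "\<And>\<theta>. \<theta> \<in> interior (effective_domain M) \<Longrightarrow> (deriv ^^ 2) (cgf M) \<theta> \<ge> \<delta>"
    and \<tau>_in_domain: "\<tau> \<in> interior (effective_domain M)"
    and \<tau>_eq: "deriv (cgf M) \<tau> = x"
    and \<tau>_nonzero: "\<tau> \<noteq> 0"
begin

abbreviation D :: "real set" where
  "D \<equiv> interior (effective_domain M)"

abbreviation K :: "nat \<Rightarrow> real \<Rightarrow> real" where
  "K r \<equiv> (deriv ^^ r) (cgf M)"

abbreviation "G \<equiv> gap_avg M \<tau>"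

abbreviation "H \<equiv> slope_avg M \<tau>"

abbreviation "W' \<equiv> w_deriv M \<tau>"

abbreviation "p \<equiv> w_quotient M \<tau>"

lemma convex_D: "convex D"
  by (intro convex_interior convex_effective_domain M)

lemma K_deriv: "\<theta> \<in> D \<Longrightarrow> (K r has_real_derivative K (Suc r) \<theta>) (at \<theta>)"
  using cgf_smooth[OF M] by blast

lemma continuous_on_K: "continuous_on D (K r)"
  using K_deriv DERIV_isCont by (blast intro: continuous_at_imp_continuous_on)

lemma continuous_on_G: "continuous_on D G" and continuous_on_H: "continuous_on D H"
  unfolding gap_avg_def slope_avg_def
  by (intro continuous_on_seg_avg convex_D \<tau>_in_domain continuous_on_K continuous_intros)+

lemma H_ge: "\<theta> \<in> D \<Longrightarrow> H \<theta> \<ge> \<delta>"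
  using seg_avg_lower_bound[OF convex_D \<tau>_in_domain _ continuous_on_K, of \<theta> "\<lambda>t. 1" \<delta> 2] deriv2_ge
  by (auto simp: slope_avg_def)

text \<open>The weight \<open>1 - t\<close> has total mass one half, whence the factor 2.\<close>

lemma G_ge: "\<theta> \<in> D \<Longrightarrow> 2 * G \<theta> \<ge> \<delta>"
  using seg_avg_lower_bound[OF convex_D \<tau>_in_domain _ continuous_on_K, of \<theta> "\<lambda>t. 1 - t" \<delta> 2] deriv2_ge
  unfolding integral_one_minus by (auto simp: gap_avg_def continuous_intros)

lemma deriv_minus_x: "\<theta> \<in> D \<Longrightarrow> K 1 \<theta> - x = (\<theta> - \<tau>) * H \<theta>"
  unfolding slope_avg_def using seg_avg_of_deriv[OF convex_D \<tau>_in_domain, of \<theta> "K 1" "K 2"] K_deriv[of _ 1] \<tau>_eq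
  by (simp add: numeral_2_eq_2)

text \<open>Uniqueness: at another solution the product
  \<open>(\<theta> - \<tau>) * H \<theta>\<close> would vanish although \<open>H\<close> is at least
  \<open>\<delta>\<close>.\<close>

lemma saddlepoint_eq: "saddlepoint M x = \<tau>"
  unfolding saddlepoint_def
proof (rule the_equality)
  show "\<tau> \<in> D \<and> deriv (cgf M) \<tau> = x"
    using \<tau>_in_domain \<tau>_eq by blast
  fix \<theta> assume \<theta>: "\<theta> \<in> D \<and> deriv (cgf M) \<theta> = x"
  then show "\<theta> = \<tau>"
    using deriv_minus_x[of \<theta>] H_ge[of \<theta>] \<delta>_pos by auto
qed

lemma cgf_gap: "\<theta> \<in> D \<Longrightarrow> (cgf M \<theta> - x * \<theta>) - (cgf M \<tau> - x * \<tau>) = (\<theta> - \<tau>)\<^sup>2 * G \<theta>"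
  unfolding gap_avg_def
  using seg_avg_Taylor[OF convex_D \<tau>_in_domain, of \<theta> "K 0" "K 1" "K 2"] K_deriv[of _ 1] K_deriv[of _ 0] \<tau>_eq
  by (simp add: numeral_2_eq_2 algebra_simps)

lemma w_fun_eq: "\<theta> \<in> D \<Longrightarrow> w_fun M x \<theta> = w_hat M x + (\<theta> - \<tau>) * sqrt (2 * G \<theta>)"
proof -
  assume "\<theta> \<in> D"
  have "sqrt (2 * ((\<theta> - \<tau>)\<^sup>2 * G \<theta>)) = \<bar>\<theta> - \<tau>\<bar> * sqrt (2 * G \<theta>)"
    by (metis mult.left_commute real_sqrt_abs real_sqrt_mult)
  then have "sgn1 (\<theta> - \<tau>) * sqrt (2 * ((\<theta> - \<tau>)\<^sup>2 * G \<theta>)) = (\<theta> - \<tau>) * sqrt (2 * G \<theta>)"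
    by (simp add: sgn1_def)
  then show ?thesis
    unfolding w_fun_def Let_def saddlepoint_eq cgf_gap[OF \<open>\<theta> \<in> D\<close>] by simp
qed

lemma w_fun_\<tau>: "w_fun M x \<tau> = w_hat M x"
  using w_fun_eq[OF \<tau>_in_domain] by simp

text \<open>As the cumulant generating function vanishes at 0, the square root in
  \<open>w_fun\<close> at 0 is the one in \<open>w_hat\<close>, and the signs are opposite because
  \<open>sgn1\<close> is odd away from 0.\<close>

lemma w_fun_0: "w_fun M x 0 = 0"
proof -
  have "sgn1 (0 - \<tau>) = - sgn1 \<tau>" using \<tau>_nonzero by (simp add: sgn1_def)
  then show ?thesis
    unfolding w_fun_def w_hat_def Let_def saddlepoint_eq by (simp add: cgf_0[OF M])
qed

lemma W'_pos: "\<theta> \<in> D \<Longrightarrow> W' \<theta> > 0"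
  unfolding w_deriv_def using H_ge[of \<theta>] G_ge[of \<theta>] \<delta>_pos by (intro mult_pos_pos) auto

text \<open>Away from the saddlepoint this is the chain rule, as \<^term>\<open>w_fun M x\<close> is \<open>\<plusminus> sqrt\<close> of a
  positive function; at the saddlepoint the difference quotient is \<^term>\<open>\<lambda>\<theta>. sqrt (2 * G \<theta>)\<close>.\<close>
lemma w_fun_deriv:
  assumes \<theta>: "\<theta> \<in> D"
  shows "(w_fun M x has_real_derivative W' \<theta>) (at \<theta>)"
proof (cases "\<theta> = \<tau>")
  case True
  have "isCont (\<lambda>\<theta>. sqrt (2 * G \<theta>)) \<tau>"
    using continuous_on_G \<tau>_in_domain
    by (intro continuous_intros) (simp add: continuous_on_eq_continuous_at)
  then have "((\<lambda>\<theta>. w_hat M x + (\<theta> - \<tau>) * sqrt (2 * G \<theta>)) has_real_derivative sqrt (2 * G \<tau>)) (at \<tau>)"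
    unfolding CARAT_DERIV by (intro exI[of _ "\<lambda>\<theta>. sqrt (2 * G \<theta>)"]) (simp add: mult.commute)
  then have "(w_fun M x has_real_derivative sqrt (2 * G \<tau>)) (at \<tau>)"
    by (rule has_field_derivative_transform_within_open[OF _ open_interior \<tau>_in_domain]) (simp add: w_fun_eq)
  \<comment> \<open>At \<open>\<tau>\<close> both averages are taken of a constant, with weights of
    mass one half and one; so \<open>W' \<tau>\<close> is \<open>H \<tau> / sqrt (H \<tau>)\<close>,
    the derivative just found.\<close>
  moreover have "2 * G \<tau> = H \<tau>"
    using integral_one_minus by (simp add: gap_avg_def slope_avg_def seg_avg_def)
  ultimately show ?thesis
    using G_ge[OF \<tau>_in_domain] \<delta>_pos by (simp add: True w_deriv_def real_div_sqrt flip: divide_inverse)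
next
  case False
  define h where "h \<theta> = (cgf M \<theta> - x * \<theta>) - (cgf M \<tau> - x * \<tau>)" for \<theta>
  have h: "h \<theta> = (\<theta> - \<tau>)\<^sup>2 * G \<theta>" by (simp add: h_def cgf_gap[OF \<theta>])
  have h_pos: "h \<theta> > 0"
    unfolding h using G_ge[OF \<theta>] \<delta>_pos False by (intro mult_pos_pos) auto
  have "(h has_real_derivative K 1 \<theta> - x) (at \<theta>)"
    unfolding h_def using K_deriv[OF \<theta>, of 0] by (auto intro!: derivative_eq_intros)
  then have dh: "((\<lambda>\<theta>'. w_hat M x + sgn1 (\<theta> - \<tau>) * sqrt (2 * h \<theta>')) has_real_derivative
      sgn1 (\<theta> - \<tau>) * ((K 1 \<theta> - x) / sqrt (2 * h \<theta>))) (at \<theta>)"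
    using h_pos by (auto intro!: derivative_eq_intros simp: field_simps)
  have "sqrt (2 * h \<theta>) = \<bar>\<theta> - \<tau>\<bar> * sqrt (2 * G \<theta>)"
    unfolding h by (metis mult.left_commute real_sqrt_abs real_sqrt_mult)
  moreover have "sgn1 (\<theta> - \<tau>) * (\<theta> - \<tau>) = \<bar>\<theta> - \<tau>\<bar>"
    by (simp add: sgn1_def)
  ultimately have "sgn1 (\<theta> - \<tau>) * ((K 1 \<theta> - x) / sqrt (2 * h \<theta>)) = W' \<theta>"
    using False unfolding deriv_minus_x[OF \<theta>] w_deriv_def
    by (simp add: divide_inverse flip: mult.assoc)
  with dh have *: "((\<lambda>\<theta>'. w_hat M x + sgn1 (\<theta> - \<tau>) * sqrt (2 * h \<theta>')) has_real_derivative W' \<theta>) (at \<theta>)"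
    by simp
  \<comment> \<open>On the half-line on the same side of \<open>\<tau>\<close> as
    \<open>\<theta>\<close> the sign is constant, which justifies differentiating with the sign
    frozen at \<open>\<theta>\<close>.\<close>
  define U where "U = (if \<theta> > \<tau> then {\<tau><..} else {..<\<tau>})"
  show ?thesis
  proof (rule has_field_derivative_transform_within_open[OF *])
    show "open U" "\<theta> \<in> U" using False by (auto simp: U_def)
    show "w_hat M x + sgn1 (\<theta> - \<tau>) * sqrt (2 * h \<theta>') = w_fun M x \<theta>'" if "\<theta>' \<in> U" for \<theta>'
    proof -
      have "sgn1 (\<theta> - \<tau>) = sgn1 (\<theta>' - \<tau>)"
        using that False by (auto simp: U_def sgn1_def split: if_splits)
      then show ?thesis by (simp add: w_fun_def saddlepoint_eq h_def)
    qed
  qed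
qed

section \<open>The inverse function and the regular form of \<open>psi\<close>\<close>

lemma continuous_on_w_fun: "continuous_on D (w_fun M x)"
  using w_fun_deriv DERIV_isCont by (blast intro: continuous_at_imp_continuous_on)

text \<open>The derivative is positive on an interval, so the function is strictly increasing; this
  makes \<open>inv_into\<close> a genuine inverse.\<close>

lemma inj_on_w_fun: "inj_on (w_fun M x) D"
proof -
  have "w_fun M x a < w_fun M x b" if "a \<in> D" "b \<in> D" "a < b" for a b
  proof (rule DERIV_pos_imp_increasing[OF \<open>a < b\<close>])
    fix \<theta> assume "a \<le> \<theta>" "\<theta> \<le> b"
    then have "\<theta> \<in> D"
      using that convex_D is_interval_convex_1 mem_is_interval_1_I by blast
    then show "\<exists>y. (w_fun M x has_real_derivative y) (at \<theta>) \<and> y > 0"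
      using w_fun_deriv W'_pos by blast
  qed
  then show ?thesis
    by (metis inj_onI linorder_neqE_linordered_idom order_less_irrefl)
qed

lemma theta_fun_w_fun: "\<theta> \<in> D \<Longrightarrow> theta_fun M x (w_fun M x \<theta>) = \<theta>"
  unfolding theta_fun_def by (rule inv_into_f_f[OF inj_on_w_fun])

lemma theta_fun_deriv:
  assumes \<theta>: "\<theta> \<in> D"
  shows "(theta_fun M x has_real_derivative inverse (W' \<theta>)) (at (w_fun M x \<theta>))"
  using W'_pos[OF \<theta>] theta_fun_w_fun continuous_on_w_fun
  by (intro has_field_derivative_inverse_strong[OF w_fun_deriv[OF \<theta>] _ open_interior \<theta>]) auto

text \<open>Invariance of domain for a continuous injection. Openness of the image allows repeated
  differentiation in the variable \<open>w\<close>.\<close>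

lemma open_w_fun_image:
  assumes "open J" "J \<subseteq> D"
  shows "open (w_fun M x ` J)"
  using assms continuous_on_w_fun inj_on_w_fun
  by (intro invariance_of_domain) (auto intro: continuous_on_subset inj_on_subset)

lemma continuous_on_W': "continuous_on D W'"
proof -
  have "sqrt (2 * G \<theta>) \<noteq> 0" if "\<theta> \<in> D" for \<theta>
    using G_ge[OF that] \<delta>_pos by simp
  then show ?thesis
    unfolding w_deriv_def[abs_def] by (intro continuous_intros continuous_on_H continuous_on_G) auto
qed

lemma w_fun_eq_p: "\<theta> \<in> D \<Longrightarrow> w_fun M x \<theta> = \<theta> * p \<theta>"
  using seg_avg_of_deriv[OF convex_D zero_in_domain, of \<theta> "w_fun M x" W'] w_fun_deriv w_fun_0
  by (simp add: w_quotient_def)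

text \<open>Since \<open>w = \<theta> p(\<theta>)\<close>, the function \<open>\<psi>\<close> is minus the logarithmic derivative of \<open>p(\<theta>(w))\<close>; in this
  form it has no singularity at \<open>w = 0\<close>.\<close>
lemma psi_eq:
  assumes \<theta>: "\<theta> \<in> D" "\<theta> \<noteq> 0" and p': "(p has_real_derivative p') (at \<theta>)"
  shows "psi M x (w_fun M x \<theta>) = - 1 * (p' * (inverse (W' \<theta>) * inverse (p \<theta>)))"
proof -
  have "((\<lambda>\<theta>. \<theta> * p \<theta>) has_real_derivative p \<theta> + \<theta> * p') (at \<theta>)"
    using p' by (auto intro!: derivative_eq_intros)
  then have "(w_fun M x has_real_derivative p \<theta> + \<theta> * p') (at \<theta>)"
    by (rule has_field_derivative_transform_within_open[OF _ open_interior \<theta>(1)]) (simp add: w_fun_eq_p)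
  \<comment> \<open>Comparing the two derivatives of \<open>w_fun\<close> gives
    \<open>W' \<theta> - p \<theta> = \<theta> * p'\<close>; this factor \<open>\<theta>\<close>
    cancels the one in the denominator of \<open>psi\<close>.\<close>
  then have W': "W' \<theta> = p \<theta> + \<theta> * p'"
    using w_fun_deriv[OF \<theta>(1)] DERIV_unique by blast
  have "w_fun M x \<theta> \<noteq> 0"
    using inj_onD[OF inj_on_w_fun, of \<theta> 0] w_fun_0 \<theta> zero_in_domain by auto
  then have "p \<theta> \<noteq> 0" using w_fun_eq_p[OF \<theta>(1)] by auto
  have "psi M x (w_fun M x \<theta>) = inverse (W' \<theta>) / \<theta> - 1 / (\<theta> * p \<theta>)"
    using DERIV_imp_deriv[OF theta_fun_deriv[OF \<theta>(1)]] theta_fun_w_fun[OF \<theta>(1)] w_fun_eq_p[OF \<theta>(1)]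
    by (simp add: psi_def)
  also have "\<dots> = (p \<theta> - W' \<theta>) / (\<theta> * W' \<theta> * p \<theta>)"
    using \<open>p \<theta> \<noteq> 0\<close> \<theta>(2) W'_pos[OF \<theta>(1)] by (simp add: field_simps)
  also have "\<dots> = - 1 * (p' * (inverse (W' \<theta>) * inverse (p \<theta>)))"
    using \<open>p \<theta> \<noteq> 0\<close> \<theta>(2) W'_pos[OF \<theta>(1)] by (subst (1) W') (simp add: field_simps)
  finally show ?thesis .
qed

text \<open>The value at \<open>\<tau>\<close> is nonzero by injectivity, since \<open>w_fun\<close>
  vanishes at 0 and \<open>\<tau>\<close> is not 0. The derivatives of \<open>psi\<close> can thus
  be evaluated away from its singularity.\<close>

lemma w_hat_mem:
  assumes "\<tau> \<in> J" "J \<subseteq> D"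
  shows "w_hat M x \<in> w_fun M x ` J - {0}"
proof -
  have "w_fun M x \<tau> \<noteq> 0"
    using inj_onD[OF inj_on_w_fun, of \<tau> 0] w_fun_0 \<tau>_nonzero \<tau>_in_domain zero_in_domain by auto
  then show ?thesis
    using assms by (auto simp flip: w_fun_\<tau>)
qed

end

section \<open>Uniform bounds for the derivatives of \<open>psi\<close>\<close>

text \<open>The closure rules are applied in turn to the averages, to the derivative of
  \<open>w_fun\<close> and to its quotient by \<open>\<theta>\<close>, and the result is pulled back
  along \<open>theta_fun\<close>. The hypothesis on the second derivatives holds at every order,
  which absorbs the order lost in each average.\<close>

lemma psi_higher_deriv_bound:
  fixes M :: "real \<Rightarrow> real measure"
  assumes cgf: "\<forall>\<^sub>F \<epsilon> in at_right 0. strongly_convex_cgf (M \<epsilon>) x \<delta> (\<tau> \<epsilon>)"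
    and J: "\<forall>\<^sub>F \<epsilon> in at_right 0. {-B<..<B} \<subseteq> interior (effective_domain (M \<epsilon>))"
    and \<tau>: "\<forall>\<^sub>F \<epsilon> in at_right 0. \<tau> \<epsilon> \<in> {-B<..<B}" and \<delta>: "\<delta> > 0" and B: "B > 0"
    and K2: "\<And>n. scaled (\<lambda>\<epsilon>. {-B<..<B}) n 0 (\<lambda>\<epsilon>. (deriv ^^ 2) (cgf (M \<epsilon>)))"
  shows "\<exists>C. \<forall>\<^sub>F \<epsilon> in at_right 0. \<bar>(deriv ^^ k) (psi (M \<epsilon>) x) (w_hat (M \<epsilon>) x)\<bar> \<le> C * \<epsilon> ^ Suc k"
proof -
  let ?J = "{-B<..<B}" and ?S = "\<lambda>\<epsilon>::real. {-B<..<B}"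
  let ?G = "\<lambda>\<epsilon>. gap_avg (M \<epsilon>) (\<tau> \<epsilon>)" and ?H = "\<lambda>\<epsilon>. slope_avg (M \<epsilon>) (\<tau> \<epsilon>)"
  let ?W = "\<lambda>\<epsilon>. w_deriv (M \<epsilon>) (\<tau> \<epsilon>)" and ?p = "\<lambda>\<epsilon>. w_quotient (M \<epsilon>) (\<tau> \<epsilon>)"
  let ?\<theta> = "\<lambda>\<epsilon>. theta_fun (M \<epsilon>) x"
  have G: "scaled ?S n 0 (\<lambda>\<epsilon> \<theta>. 2 * ?G \<epsilon> \<theta>)" for n
    using scaled_mult[OF scaled_const, of ?S n 0 ?G 2]
      scaled_average[OF _ _ \<tau> _ _ K2, of "\<lambda>t. 1 - t"]
    by (simp add: gap_avg_def continuous_intros)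
  have G_ge: "\<forall>\<^sub>F \<epsilon> in at_right 0. \<forall>\<theta>\<in>?J. \<delta> \<le> 2 * ?G \<epsilon> \<theta>"
    using cgf J by eventually_elim (blast intro: strongly_convex_cgf.G_ge)
  have H: "scaled ?S n 0 ?H" for n
    using scaled_average[OF _ _ \<tau> _ _ K2, of "\<lambda>t. 1"] by (simp add: slope_avg_def)
  have R: "scaled ?S n 0 (\<lambda>\<epsilon> \<theta>. sqrt (2 * ?G \<epsilon> \<theta>))" for n
    by (rule scaled_sqrt[OF \<delta> G_ge G])
  have R_ge: "\<forall>\<^sub>F \<epsilon> in at_right 0. \<forall>\<theta>\<in>?J. sqrt \<delta> \<le> sqrt (2 * ?G \<epsilon> \<theta>)"
    using G_ge by eventually_elim auto
  have W: "scaled ?S n 0 ?W" for n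
    unfolding w_deriv_def[abs_def]
    using scaled_mult[OF H scaled_inverse[OF _ R_ge R]] \<delta> by simp
  obtain C where C: "C > 0" "\<forall>\<^sub>F \<epsilon> in at_right 0. \<forall>\<theta>\<in>?J. \<bar>sqrt (2 * ?G \<epsilon> \<theta>)\<bar> \<le> C * \<epsilon> ^ 0"
    using scaled_boundE[OF R] by blast
  \<comment> \<open>The numerator of \<open>?W\<close> is at least \<open>\<delta>\<close> and its
    denominator at most \<open>C\<close>.\<close>
  define c where "c = \<delta> * inverse C"
  have c: "c > 0" using C(1) \<delta> by (simp add: c_def)
  have W_ge: "\<forall>\<^sub>F \<epsilon> in at_right 0. \<forall>\<theta>\<in>?J. c \<le> ?W \<epsilon> \<theta>"
    using cgf J C(2) R_ge
  proof eventually_elim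
    case (elim \<epsilon>)
    show ?case
    proof
      fix \<theta> assume \<theta>: "\<theta> \<in> ?J"
      have "\<delta> \<le> ?H \<epsilon> \<theta>"
        using elim(1,2) \<theta> by (blast intro: strongly_convex_cgf.H_ge)
      moreover have "sqrt (2 * ?G \<epsilon> \<theta>) \<le> C" "sqrt (2 * ?G \<epsilon> \<theta>) > 0"
        using elim(3,4) \<theta> \<delta> real_sqrt_gt_zero[OF \<delta>] by fastforce+
      ultimately show "c \<le> ?W \<epsilon> \<theta>"
        unfolding c_def w_deriv_def using \<delta> C(1) by (intro mult_mono le_imp_inverse_le) auto
    qed
  qed
  have Q: "scaled ?S n 0 (\<lambda>\<epsilon> \<theta>. inverse (?W \<epsilon> \<theta>))" for n
    by (rule scaled_inverse[OF c W_ge W])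
  have p: "scaled ?S n 0 ?p" for n
    using scaled_average[OF _ _ _ _ _ W, of "\<lambda>_. 0" "\<lambda>t. 1"] B by (simp add: w_quotient_def)
  have p_ge: "\<forall>\<^sub>F \<epsilon> in at_right 0. \<forall>\<theta>\<in>?J. c \<le> ?p \<epsilon> \<theta>"
    using cgf J W_ge
  proof eventually_elim
    case (elim \<epsilon>)
    have "continuous_on ?J (?W \<epsilon>)"
      using continuous_on_subset[OF strongly_convex_cgf.continuous_on_W'[OF elim(1)] elim(2)] .
    then have "c * integral {0..1} (\<lambda>t::real. 1) \<le> seg_avg (\<lambda>t. 1) 0 (?W \<epsilon>) \<theta>" if "\<theta> \<in> ?J" for \<theta>
      using that B elim(3) by (intro seg_avg_lower_bound[of ?J]) auto
    then show ?case by (simp add: w_quotient_def)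
  qed
  \<comment> \<open>The derivative of \<open>?p\<close> has exponent 1; this is the source of the
    single power of the parameter in \<open>psi\<close> itself.\<close>
  obtain p' where p': "\<forall>\<^sub>F \<epsilon> in at_right 0. \<forall>\<theta>\<in>?J. (?p \<epsilon> has_real_derivative p' \<epsilon> \<theta>) (at \<theta>)"
    "scaled ?S k (Suc 0) p'"
    using p by (rule scaled_SucE)
  let ?E = "\<lambda>\<epsilon> \<theta>. - 1 * (p' \<epsilon> \<theta> * (inverse (?W \<epsilon> \<theta>) * inverse (?p \<epsilon> \<theta>)))"
  have E: "scaled ?S k (Suc 0) ?E"
    using scaled_mult[OF scaled_const scaled_mult[OF p'(2) scaled_mult[OF Q scaled_inverse[OF c p_ge p]]], of "- 1"]
    by simp
  \<comment> \<open>The point 0 is removed because \<open>psi\<close> has only a division-by-zero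
    value there; the set stays open.\<close>
  define V where "V \<epsilon> = w_fun (M \<epsilon>) x ` ?J - {0}" for \<epsilon>
  have V_open: "\<forall>\<^sub>F \<epsilon> in at_right 0. open (V \<epsilon>)"
    using cgf J unfolding V_def
    by eventually_elim (auto intro!: open_Diff strongly_convex_cgf.open_w_fun_image)
  have maps: "\<forall>\<^sub>F \<epsilon> in at_right 0. ?\<theta> \<epsilon> ` V \<epsilon> \<subseteq> ?J"
    using cgf J
  proof eventually_elim
    case (elim \<epsilon>)
    then show ?case
      by (auto simp: V_def strongly_convex_cgf.theta_fun_w_fun[OF elim(1)] subset_iff)
  qed
  have d\<theta>: "\<forall>\<^sub>F \<epsilon> in at_right 0. \<forall>w\<in>V \<epsilon>. (?\<theta> \<epsilon> has_real_derivative inverse (?W \<epsilon> (?\<theta> \<epsilon> w))) (at w)"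
    using cgf J
  proof eventually_elim
    case (elim \<epsilon>)
    show ?case
    proof
      fix w assume "w \<in> V \<epsilon>"
      then obtain \<theta> where "\<theta> \<in> interior (effective_domain (M \<epsilon>))" "w = w_fun (M \<epsilon>) x \<theta>"
        using elim(2) by (auto simp: V_def)
      then show "(?\<theta> \<epsilon> has_real_derivative inverse (?W \<epsilon> (?\<theta> \<epsilon> w))) (at w)"
        using strongly_convex_cgf.theta_fun_deriv[OF elim(1)] strongly_convex_cgf.theta_fun_w_fun[OF elim(1)]
        by simp
    qed
  qed
  have "scaled V k (Suc 0) (\<lambda>\<epsilon> w. ?E \<epsilon> (?\<theta> \<epsilon> w))"
    by (rule scaled_compose'[OF maps d\<theta> scaled_inverse_function[OF maps d\<theta> Q] E])
  moreover have "\<forall>\<^sub>F \<epsilon> in at_right 0. \<forall>w\<in>V \<epsilon>. ?E \<epsilon> (?\<theta> \<epsilon> w) = psi (M \<epsilon>) x w"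
    using cgf J p'(1)
  proof eventually_elim
    case (elim \<epsilon>)
    show ?case
    proof
      fix w assume "w \<in> V \<epsilon>"
      then obtain \<theta> where \<theta>: "\<theta> \<in> ?J" "w = w_fun (M \<epsilon>) x \<theta>" "w \<noteq> 0"
        by (auto simp: V_def)
      then have "\<theta> \<in> interior (effective_domain (M \<epsilon>))" "\<theta> \<noteq> 0"
        using elim(2) strongly_convex_cgf.w_fun_0[OF elim(1)] by auto
      then show "?E \<epsilon> (?\<theta> \<epsilon> w) = psi (M \<epsilon>) x w"
        using strongly_convex_cgf.psi_eq[OF elim(1), of \<theta> "p' \<epsilon> \<theta>"]
          strongly_convex_cgf.theta_fun_w_fun[OF elim(1), of \<theta>] \<theta> elim(3) by simp
    qed
  qed
  ultimately have "scaled V k (Suc 0) (\<lambda>\<epsilon>. psi (M \<epsilon>) x)"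
    by (rule_tac scaled_cong[OF V_open])
  then obtain C' where C': "\<forall>\<^sub>F \<epsilon> in at_right 0. \<forall>w\<in>V \<epsilon>. \<bar>(deriv ^^ k) (psi (M \<epsilon>) x) w\<bar> \<le> C' * \<epsilon> ^ (Suc 0 + k)"
    using scaled_higher_deriv[OF V_open] by blast
  have "\<forall>\<^sub>F \<epsilon> in at_right 0. \<bar>(deriv ^^ k) (psi (M \<epsilon>) x) (w_hat (M \<epsilon>) x)\<bar> \<le> C' * \<epsilon> ^ Suc k"
    using C' cgf J \<tau>
  proof eventually_elim
    case (elim \<epsilon>)
    then show ?case
      using strongly_convex_cgf.w_hat_mem[OF elim(2,4,3)] by (simp add: V_def)
  qed
  then show ?thesis by blast
qed

section \<open>Translating the convergence hypotheses into scaling\<close>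

text \<open>The shift \<open>m\<close> separates the order of the derivative from the exponent; with
  \<open>m = 2\<close> it matches the exponent \<open>r - 2\<close> in the limsup
  hypothesis.\<close>

lemma scaled_higher_deriv_family:
  fixes f :: "real \<Rightarrow> real \<Rightarrow> real"
  assumes deriv: "\<And>r. \<forall>\<^sub>F \<epsilon> in at_right 0. \<forall>x\<in>S \<epsilon>. ((deriv ^^ r) (f \<epsilon>) has_real_derivative (deriv ^^ Suc r) (f \<epsilon>) x) (at x)"
    and bound: "\<And>r. \<exists>C. \<forall>\<^sub>F \<epsilon> in at_right 0. \<forall>x\<in>S \<epsilon>. \<bar>(deriv ^^ (r + m)) (f \<epsilon>) x\<bar> \<le> C * \<epsilon> ^ r"
  shows "scaled S n r (\<lambda>\<epsilon>. (deriv ^^ (r + m)) (f \<epsilon>))"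
proof (induction n arbitrary: r)
  case 0
  then show ?case using bound by simp
next
  case (Suc n)
  show ?case
    by (rule scaled_SucI[OF _ deriv]) (use bound Suc[of "Suc r"] in simp_all)
qed

text \<open>The limit is bounded on the compact set, and eventually the family is within 1 of
  it.\<close>

lemma uniform_limit_imp_bound:
  fixes K :: "real \<Rightarrow> real \<Rightarrow> real" and K0 :: "real \<Rightarrow> real"
  assumes "uniform_limit C K K0 (at_right 0)" "compact C" "continuous_on C K0"
  shows "\<exists>A. \<forall>\<^sub>F \<epsilon> in at_right 0. \<forall>x\<in>C. \<bar>K \<epsilon> x\<bar> \<le> A"
proof -
  obtain A where A: "\<And>x. x \<in> C \<Longrightarrow> \<bar>K0 x\<bar> \<le> A"
    using compact_imp_bounded[OF compact_continuous_image[OF assms(3,2)]] by (auto simp: bounded_iff)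
  have "\<forall>\<^sub>F \<epsilon> in at_right 0. \<forall>x\<in>C. dist (K \<epsilon> x) (K0 x) < 1"
    by (rule uniform_limitD[OF assms(1)]) simp
  then have "\<forall>\<^sub>F \<epsilon> in at_right 0. \<forall>x\<in>C. \<bar>K \<epsilon> x\<bar> \<le> A + 1"
  proof eventually_elim
    case (elim \<epsilon>)
    show ?case
    proof
      fix x assume "x \<in> C"
      then show "\<bar>K \<epsilon> x\<bar> \<le> A + 1"
        using elim A[of x] by (force simp: dist_real_def)
    qed
  qed
  then show ?thesis by blast
qed

lemma Limsup_SUP_finite_imp_bound:
  fixes g :: "real \<Rightarrow> 'a \<Rightarrow> real"
  assumes "Limsup (at_right 0) (\<lambda>\<epsilon>. SUP \<theta>\<in>C. ereal (\<bar>g \<epsilon> \<theta>\<bar> / \<epsilon> ^ r)) < \<infinity>"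
  shows "\<exists>A. \<forall>\<^sub>F \<epsilon> in at_right 0. \<forall>\<theta>\<in>C. \<bar>g \<epsilon> \<theta>\<bar> \<le> A * \<epsilon> ^ r"
proof -
  obtain A where "Limsup (at_right 0) (\<lambda>\<epsilon>. SUP \<theta>\<in>C. ereal (\<bar>g \<epsilon> \<theta>\<bar> / \<epsilon> ^ r)) < ereal A"
    using assms by (auto simp: less_PInf_Ex_of_nat)
  from Limsup_lessD[OF this] eventually_at_right_less[of 0]
  have "\<forall>\<^sub>F \<epsilon> in at_right 0. \<forall>\<theta>\<in>C. \<bar>g \<epsilon> \<theta>\<bar> \<le> A * \<epsilon> ^ r"
  proof eventually_elim
    case (elim \<epsilon>)
    show ?case
    proof
      fix \<theta> assume "\<theta> \<in> C"
      then have "ereal (\<bar>g \<epsilon> \<theta>\<bar> / \<epsilon> ^ r) < ereal A"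
        using elim(1) by (meson SUP_upper le_less_trans)
      then show "\<bar>g \<epsilon> \<theta>\<bar> \<le> A * \<epsilon> ^ r"
        using elim(2) by (simp add: divide_less_eq)
    qed
  qed
  then show ?thesis by blast
qed

section \<open>Existence of the saddlepoint and the rates\<close>

theorem theorem2:
  fixes \<mu> :: "real \<Rightarrow> real measure" and x \<delta>\<^sub>0 :: real and I :: "real \<Rightarrow> real set"
  assumes distr: "\<And>\<epsilon>. \<epsilon> \<in> {0..1} \<Longrightarrow> real_distribution (\<mu> \<epsilon>)"
    and x_neq: "(\<integral>y. y \<partial>\<mu> 0) \<noteq> x"
    and A1: "\<And>\<epsilon>. \<epsilon> \<in> {0..1} \<Longrightarrow>
        \<exists>a b. 0 \<in> {a<..<b} \<and> {a<..<b} \<subseteq> effective_domain (\<mu> \<epsilon>)"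
    and A2_support: "\<And>\<epsilon>. \<epsilon> \<in> {0..1} \<Longrightarrow> measure_support (\<mu> \<epsilon>) = UNIV"
    and A2_char: "\<And>\<epsilon>. \<epsilon> \<in> {0..1} \<Longrightarrow> integrable lborel (char (\<mu> \<epsilon>))"
    and A3_pos: "\<delta>\<^sub>0 > 0"
    and A3: "\<And>\<epsilon> \<theta>. \<epsilon> \<in> {0..1} \<Longrightarrow> \<theta> \<in> interior (effective_domain (\<mu> \<epsilon>)) \<Longrightarrow>
        (deriv ^^ 2) (cgf (\<mu> \<epsilon>)) \<theta> \<ge> \<delta>\<^sub>0"
    and A4_interval: "\<And>\<epsilon>. \<epsilon> \<in> {0..1} \<Longrightarrow>
        is_interval (I \<epsilon>) \<and> I \<epsilon> \<subseteq> effective_domain (\<mu> \<epsilon>)"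
    and A4_mono: "\<And>\<epsilon> \<epsilon>'. \<epsilon> \<in> {0..1} \<Longrightarrow> \<epsilon>' \<in> {0..1} \<Longrightarrow> \<epsilon> \<ge> \<epsilon>' \<Longrightarrow> I \<epsilon> \<subseteq> I \<epsilon>'"
    and A4_union: "(\<Union>\<epsilon>\<in>{0<..1}. I \<epsilon>) = UNIV"
    and A5_conv: "\<And>r C. compact C \<Longrightarrow>
        uniform_limit C (\<lambda>\<epsilon>. (deriv ^^ r) (cgf (\<mu> \<epsilon>))) ((deriv ^^ r) (cgf (\<mu> 0))) (at_right 0)"
    and A5_bound: "\<And>r C. r \<ge> 3 \<Longrightarrow> compact C \<Longrightarrow>
        Limsup (at_right 0)
          (\<lambda>\<epsilon>. SUP \<theta>\<in>C. ereal (\<bar>(deriv ^^ r) (cgf (\<mu> \<epsilon>)) \<theta>\<bar> / \<epsilon> ^ (r - 2))) < \<infinity>"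
  shows "(\<lambda>\<epsilon>. Psi (\<mu> \<epsilon>) x 0 (w_hat (\<mu> \<epsilon>) x)) \<in> O[at_right 0](\<lambda>\<epsilon>. \<epsilon>)
    \<and> (\<forall>m\<ge>1. (\<lambda>\<epsilon>. Psi (\<mu> \<epsilon>) x m (w_hat (\<mu> \<epsilon>) x)) \<in> O[at_right 0](\<lambda>\<epsilon>. \<epsilon> ^ 3))"
proof -
  let ?D = "\<lambda>\<epsilon>. interior (effective_domain (\<mu> \<epsilon>))" and ?K = "\<lambda>r \<epsilon>. (deriv ^^ r) (cgf (\<mu> \<epsilon>))"
  have small: "\<forall>\<^sub>F \<epsilon> in at_right 0. \<epsilon> \<in> {0<..c}" if "c > 0" for c :: real
    using eventually_at_right_real[OF that] by eventually_elim auto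
  have K_deriv: "(?K r \<epsilon> has_real_derivative ?K (Suc r) \<epsilon> \<theta>) (at \<theta>)"
    if "\<epsilon> \<in> {0..1}" "\<theta> \<in> ?D \<epsilon>" for r \<epsilon> \<theta>
    by (rule cgf_smooth[OF distr[OF that(1)] that(2)])
  \<comment> \<open>Monotonicity down to parameter 0 puts the whole exhausting union into
    \<open>I 0\<close>, so the limit function is finite on the entire line.\<close>
  have "I \<epsilon> \<subseteq> I 0" if "\<epsilon> \<in> {0<..1}" for \<epsilon>
    using that by (intro A4_mono) auto
  then have "UNIV \<subseteq> I 0"
    unfolding A4_union[symmetric] by (rule UN_least)
  then have "effective_domain (\<mu> 0) = UNIV"
    using A4_interval[of 0] by auto
  then have D0: "?D 0 = UNIV" by simp
  note K0_deriv = K_deriv[of 0, unfolded D0, simplified]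
  have K0_growth: "\<delta>\<^sub>0 * (b - a) \<le> ?K 1 0 b - ?K 1 0 a" if "a \<le> b" for a b
    using A3[of 0] D0 K0_deriv[of 1] that
    by (intro deriv_lower_bound_imp_increment[of a b _ "?K 2 0"]) (auto simp: numeral_2_eq_2)
  have K0_cont: "continuous_on S (?K r 0)" for r S
    using K0_deriv DERIV_isCont by (blast intro: continuous_at_imp_continuous_on)
  have "?K 1 0 0 = (\<integral>y. y \<partial>\<mu> 0)"
    using deriv_cgf_0[OF distr, of 0] D0 by simp
  then have K0_0: "?K 1 0 0 \<noteq> x" using x_neq by simp
  \<comment> \<open>Growth at rate at least \<open>\<delta>\<^sub>0\<close> carries the first
    derivative from its value at 0 past \<open>x\<close> within distance \<open>t\<close>, whichever
    side \<open>x\<close> lies on.\<close>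
  define t where "t = \<bar>x - ?K 1 0 0\<bar> / \<delta>\<^sub>0"
  have t: "t \<ge> 0" "\<delta>\<^sub>0 * t = \<bar>x - ?K 1 0 0\<bar>"
    using A3_pos by (auto simp: t_def)
  have "?K 1 0 (- t) \<le> x" "x \<le> ?K 1 0 t"
    using K0_growth[of "- t" 0] K0_growth[of 0 t] t by auto
  then obtain \<theta>\<^sub>0 where \<theta>\<^sub>0: "?K 1 0 \<theta>\<^sub>0 = x"
    using IVT'[of "?K 1 0" "- t" x t] t(1) K0_cont[of "{- t..t}" 1] by auto
  \<comment> \<open>The limiting saddlepoint is nonzero because the mean differs from
    \<open>x\<close>; points within half its modulus stay away from 0.\<close>
  define \<eta> where "\<eta> = \<bar>\<theta>\<^sub>0\<bar> / 2"
  have \<eta>: "\<eta> > 0" using K0_0 \<theta>\<^sub>0 by (auto simp: \<eta>_def)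
  define B where "B = \<bar>\<theta>\<^sub>0\<bar> + \<eta> + 1"
  have B: "B > 0" using \<eta> by (simp add: B_def)

  \<comment> \<open>It is enough to capture the two endpoints: for smaller parameters both lie in
    \<open>I \<epsilon>\<close>, which is an interval.\<close>
  obtain \<epsilon>1 \<epsilon>2 where \<epsilon>12: "\<epsilon>1 \<in> {0<..1}" "- B \<in> I \<epsilon>1" "\<epsilon>2 \<in> {0<..1}" "B \<in> I \<epsilon>2"
    using A4_union by blast
  have dom: "\<forall>\<^sub>F \<epsilon> in at_right 0. {-B<..<B} \<subseteq> ?D \<epsilon>"
  proof -
    have "\<forall>\<^sub>F \<epsilon> in at_right 0. \<epsilon> \<in> {0<..min \<epsilon>1 \<epsilon>2}"
      using \<epsilon>12 by (intro small) simp
    then show ?thesis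
    proof eventually_elim
      case (elim \<epsilon>)
      then have \<epsilon>: "\<epsilon> \<in> {0..1}" "- B \<in> I \<epsilon>" "B \<in> I \<epsilon>"
        using \<epsilon>12 A4_mono[of \<epsilon>1 \<epsilon>] A4_mono[of \<epsilon>2 \<epsilon>] by auto
      then have "{-B<..<B} \<subseteq> effective_domain (\<mu> \<epsilon>)"
        using A4_interval[OF \<epsilon>(1)] mem_is_interval_1_I[of "I \<epsilon>" "- B" B] by fastforce
      then show ?case by (rule interior_maximal) simp
    qed
  qed

  \<comment> \<open>The tolerance is the margin by which the limiting derivative is known to differ
    from \<open>x\<close> at the two ends; the ends still bracket \<open>x\<close> for small
    parameters, and the intermediate value theorem gives a root.\<close>
  have "\<forall>\<^sub>F \<epsilon> in at_right 0. \<forall>\<theta>\<in>{\<theta>\<^sub>0 - \<eta>..\<theta>\<^sub>0 + \<eta>}. dist (?K 1 \<epsilon> \<theta>) (?K 1 0 \<theta>) < \<delta>\<^sub>0 * \<eta>"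
    using \<eta> A3_pos by (intro uniform_limitD[OF A5_conv]) auto
  then have "\<forall>\<^sub>F \<epsilon> in at_right 0. \<exists>\<tau>\<in>{\<theta>\<^sub>0 - \<eta>..\<theta>\<^sub>0 + \<eta>}. ?K 1 \<epsilon> \<tau> = x"
    using dom small[of 1, simplified]
  proof eventually_elim
    case (elim \<epsilon>)
    have "\<bar>?K 1 \<epsilon> (\<theta>\<^sub>0 - \<eta>) - ?K 1 0 (\<theta>\<^sub>0 - \<eta>)\<bar> < \<delta>\<^sub>0 * \<eta>" "\<bar>?K 1 \<epsilon> (\<theta>\<^sub>0 + \<eta>) - ?K 1 0 (\<theta>\<^sub>0 + \<eta>)\<bar> < \<delta>\<^sub>0 * \<eta>"
      using elim(1) \<eta> by (auto simp: dist_real_def)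
    moreover have "\<delta>\<^sub>0 * \<eta> \<le> x - ?K 1 0 (\<theta>\<^sub>0 - \<eta>)" "\<delta>\<^sub>0 * \<eta> \<le> ?K 1 0 (\<theta>\<^sub>0 + \<eta>) - x"
      using K0_growth[of "\<theta>\<^sub>0 - \<eta>" \<theta>\<^sub>0] K0_growth[of \<theta>\<^sub>0 "\<theta>\<^sub>0 + \<eta>"] \<theta>\<^sub>0 \<eta> by auto
    ultimately have "?K 1 \<epsilon> (\<theta>\<^sub>0 - \<eta>) \<le> x" "x \<le> ?K 1 \<epsilon> (\<theta>\<^sub>0 + \<eta>)" by linarith+
    moreover have "{\<theta>\<^sub>0 - \<eta>..\<theta>\<^sub>0 + \<eta>} \<subseteq> {-B<..<B}" by (auto simp: B_def)
    then have "{\<theta>\<^sub>0 - \<eta>..\<theta>\<^sub>0 + \<eta>} \<subseteq> ?D \<epsilon>" using elim(2) by blast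
    then have "continuous_on {\<theta>\<^sub>0 - \<eta>..\<theta>\<^sub>0 + \<eta>} (?K 1 \<epsilon>)"
      using K_deriv[of \<epsilon> _ 1] elim(3) by (intro continuous_at_imp_continuous_on) (fastforce intro: DERIV_isCont)
    ultimately show ?case
      using IVT'[of "?K 1 \<epsilon>" "\<theta>\<^sub>0 - \<eta>" x "\<theta>\<^sub>0 + \<eta>"] \<eta> by auto
  qed
  then have "\<forall>\<^sub>F \<epsilon> in at_right 0. \<exists>\<tau>. \<tau> \<in> {\<theta>\<^sub>0 - \<eta>..\<theta>\<^sub>0 + \<eta>} \<and> ?K 1 \<epsilon> \<tau> = x"
    by eventually_elim blast
  then obtain \<tau> where \<tau>: "\<forall>\<^sub>F \<epsilon> in at_right 0. \<tau> \<epsilon> \<in> {\<theta>\<^sub>0 - \<eta>..\<theta>\<^sub>0 + \<eta>} \<and> ?K 1 \<epsilon> (\<tau> \<epsilon>) = x"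
    by (auto simp: eventually_ex)
  have \<tau>_mem: "\<forall>\<^sub>F \<epsilon> in at_right 0. \<tau> \<epsilon> \<in> {-B<..<B}"
    using \<tau> by eventually_elim (auto simp: B_def)
  have cgf: "\<forall>\<^sub>F \<epsilon> in at_right 0. strongly_convex_cgf (\<mu> \<epsilon>) x \<delta>\<^sub>0 (\<tau> \<epsilon>)"
    using \<tau> \<tau>_mem dom small[of 1, simplified]
  proof eventually_elim
    case (elim \<epsilon>)
    then have \<epsilon>: "\<epsilon> \<in> {0..1}" by auto
    show ?case
    proof (rule strongly_convex_cgf.intro)
      show "real_distribution (\<mu> \<epsilon>)" by (rule distr[OF \<epsilon>])
      show "0 \<in> ?D \<epsilon>" "\<tau> \<epsilon> \<in> ?D \<epsilon>" using elim(2,3) B by auto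
      show "\<delta>\<^sub>0 \<le> ?K 2 \<epsilon> \<theta>" if "\<theta> \<in> ?D \<epsilon>" for \<theta> by (rule A3[OF \<epsilon> that])
      show "deriv (cgf (\<mu> \<epsilon>)) (\<tau> \<epsilon>) = x" using elim(1) by simp
      show "\<tau> \<epsilon> \<noteq> 0" using elim(1) \<eta> by (auto simp: \<eta>_def)
    qed (rule A3_pos)
  qed

  have "scaled (\<lambda>\<epsilon>. {-B<..<B}) n 0 (\<lambda>\<epsilon>. (deriv ^^ (0 + 2)) (cgf (\<mu> \<epsilon>)))" for n
  proof (rule scaled_higher_deriv_family)
    show "\<forall>\<^sub>F \<epsilon> in at_right 0. \<forall>\<theta>\<in>{-B<..<B}. (?K r \<epsilon> has_real_derivative ?K (Suc r) \<epsilon> \<theta>) (at \<theta>)" for r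
      using dom small[of 1, simplified] by eventually_elim (auto intro!: K_deriv[simplified])
    show "\<exists>C. \<forall>\<^sub>F \<epsilon> in at_right 0. \<forall>\<theta>\<in>{-B<..<B}. \<bar>?K (r + 2) \<epsilon> \<theta>\<bar> \<le> C * \<epsilon> ^ r" for r
    proof -
      have "\<exists>C. \<forall>\<^sub>F \<epsilon> in at_right 0. \<forall>\<theta>\<in>{-B..B}. \<bar>?K (r + 2) \<epsilon> \<theta>\<bar> \<le> C * \<epsilon> ^ r"
      proof (cases "r = 0")
        \<comment> \<open>The limsup hypothesis starts at the third derivative; the second is
          bounded through uniform convergence. Both hypotheses concern compact sets, hence the
          detour over the closed interval.\<close>
        case True
        then show ?thesis
          using uniform_limit_imp_bound[OF A5_conv _ K0_cont, of "{-B..B}" 2] by (simp add: numeral_2_eq_2)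
      next
        case False
        then have "Limsup (at_right 0)
            (\<lambda>\<epsilon>. SUP \<theta>\<in>{-B..B}. ereal (\<bar>?K (r + 2) \<epsilon> \<theta>\<bar> / \<epsilon> ^ (r + 2 - 2))) < \<infinity>"
          by (intro A5_bound) auto
        from Limsup_SUP_finite_imp_bound[OF this] show ?thesis
          by (simp only: diff_add_inverse2)
      qed
      then obtain C where "\<forall>\<^sub>F \<epsilon> in at_right 0. \<forall>\<theta>\<in>{-B..B}. \<bar>?K (r + 2) \<epsilon> \<theta>\<bar> \<le> C * \<epsilon> ^ r"
        by blast
      then have "\<forall>\<^sub>F \<epsilon> in at_right 0. \<forall>\<theta>\<in>{-B<..<B}. \<bar>?K (r + 2) \<epsilon> \<theta>\<bar> \<le> C * \<epsilon> ^ r"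
        by eventually_elim auto
      then show ?thesis by blast
    qed
  qed
  then have K2: "scaled (\<lambda>\<epsilon>. {-B<..<B}) n 0 (\<lambda>\<epsilon>. (deriv ^^ 2) (cgf (\<mu> \<epsilon>)))" for n
    by (simp add: numeral_2_eq_2)

  \<comment> \<open>The rate found is the exponent \<open>2 * m + 1\<close>, which is 1 for
    \<open>m = 0\<close> and at least 3 otherwise. The normal density is bounded everywhere, so the
    location of \<open>w_hat\<close> does not matter.\<close>
  have Psi: "(\<lambda>\<epsilon>. Psi (\<mu> \<epsilon>) x m (w_hat (\<mu> \<epsilon>) x)) \<in> O[at_right 0](\<lambda>\<epsilon>. \<epsilon> ^ Suc (2 * m))" for m
  proof -
    obtain C where C: "\<forall>\<^sub>F \<epsilon> in at_right 0.
        \<bar>(deriv ^^ (2 * m)) (psi (\<mu> \<epsilon>) x) (w_hat (\<mu> \<epsilon>) x)\<bar> \<le> C * \<epsilon> ^ Suc (2 * m)"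
      using psi_higher_deriv_bound[OF cgf dom \<tau>_mem A3_pos B K2] by blast
    define a where "a = 1 / sqrt (2 * pi) * \<bar>(-1) ^ m / even_double_fact m\<bar>"
    have density: "\<bar>std_normal_density w\<bar> \<le> 1 / sqrt (2 * pi)" for w
    proof -
      have "exp (- w\<^sup>2 / 2) / sqrt (2 * pi) \<le> 1 / sqrt (2 * pi)"
        by (intro divide_right_mono) auto
      then show ?thesis by (simp add: std_normal_density_def)
    qed
    have "\<forall>\<^sub>F \<epsilon> in at_right 0. norm (Psi (\<mu> \<epsilon>) x m (w_hat (\<mu> \<epsilon>) x)) \<le> a * C * norm (\<epsilon> ^ Suc (2 * m))"
      using C eventually_at_right_less[of 0]
    proof eventually_elim
      case (elim \<epsilon>)
      have "\<bar>std_normal_density (w_hat (\<mu> \<epsilon>) x)\<bar> * \<bar>(-1) ^ m / even_double_fact m\<bar> \<le> a"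
        unfolding a_def by (rule mult_right_mono[OF density]) simp
      then have "norm (Psi (\<mu> \<epsilon>) x m (w_hat (\<mu> \<epsilon>) x)) \<le> a * (C * \<epsilon> ^ Suc (2 * m))"
        unfolding Psi_def real_norm_def abs_mult by (rule mult_mono[OF _ elim(1)]) (auto simp: a_def)
      also have "\<dots> = a * C * norm (\<epsilon> ^ Suc (2 * m))"
        using elim(2) by (simp add: abs_mult)
      finally show ?case .
    qed
    then show ?thesis by (rule bigoI)
  qed
  have "(\<lambda>\<epsilon>. \<epsilon> ^ Suc (2 * m)) \<in> O[at_right 0](\<lambda>\<epsilon>::real. \<epsilon> ^ 3)" if "m \<ge> 1" for m
  proof (rule bigoI[of _ 1])
    show "\<forall>\<^sub>F \<epsilon> in at_right 0. norm (\<epsilon> ^ Suc (2 * m)) \<le> 1 * norm (\<epsilon> ^ 3 :: real)"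
      using small[of 1, simplified]
    proof eventually_elim
      case (elim \<epsilon>)
      then have "\<epsilon> ^ Suc (2 * m) \<le> \<epsilon> ^ 3" using that by (intro power_decreasing) auto
      then show ?case using elim by simp
    qed
  qed
  with Psi have "(\<lambda>\<epsilon>. Psi (\<mu> \<epsilon>) x m (w_hat (\<mu> \<epsilon>) x)) \<in> O[at_right 0](\<lambda>\<epsilon>. \<epsilon> ^ 3)" if "m \<ge> 1" for m
    using that by (blast intro: landau_o.big_trans)
  moreover have "(\<lambda>\<epsilon>. Psi (\<mu> \<epsilon>) x 0 (w_hat (\<mu> \<epsilon>) x)) \<in> O[at_right 0](\<lambda>\<epsilon>. \<epsilon>)"
    using Psi[of 0] by simp
  ultimately show ?thesis by blast
qed

end
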